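(* Let $\mathcal{H}$ be a real Hilbert space and let $f:\mathcal{H}\to\mathbb{R}$ be a convex, continuously Fréchet differentiable function whose gradient is $L$-Lipschitz continuous ($L>0$) and such that $\operatorname{argmin} f\neq\emptyset$. Let $(\epsilon_k)_{k\ge1}$ be a non-increasing sequence of positive reals with $\lim_{k\to+\infty}\epsilon_k=0$. Let $0<s<\frac1L$, and let $k_0\in\mathbb{N}$ be such that $s\in\left(0,\frac{1}{L+\epsilon_{k_0}}\right]$ (so $s\in\left(0,\frac{1}{L+\epsilon_k}\right]$ for all $k\ge k_0$). Let $k_1\ge k_0$ be such that $1-s\epsilon_k>0$ for all $k\ge k_1$. Let $(q_k)_{k\ge0}$ be a real sequence for which there is an index $k_2\ge k_1$ such that, for all $k\ge k_2$, $$(1-s\epsilon_{k+1})^2q_{k+1}^2-(1-s\epsilon_k)^2q_k^2-2sq_{k+1}+s(1-s\epsilon_k)^2q_k\le0\quad\text{and}\quad q_k\ge\frac{2s}{(1-s\epsilon_k)^2}.$$ Put $\overline{k}=k_2+1$. Let $x_0,x_1\in\mathcal{H}$ and let $(x_k)_{k\ge0}$, $(y_k)_{k\ge1}$ be generated, for all $k\ge1$, by $$y_k=x_k+b_{k-1}(x_k-x_{k-1})-c_kx_k,\qquad x_{k+1}=y_k-s\nabla f(y_k)-s\epsilon_ky_k,$$ with the coefficients $b_{k-1}$, $c_k$ determined by $s$, $(q_k)$, $(\epsilon_k)$ through the formulas given in the context. Assume that the sequence $\left(\frac{q_k\epsilon_k}{q_{k-1}\epsilon_{k-1}}\right)_{k\ge\overline{k}}$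 is bounded, that the sequence $(q_k^2\epsilon_k)_{k\ge\overline{k}-1}$ is increasing, that $\lim_{k\to+\infty}q_k^2\epsilon_k=+\infty$, and that $\lim_{k\to+\infty}\frac{q_k(\epsilon_k-\epsilon_{k+1})}{\epsilon_k}=0$. Then $(x_k)$ converges strongly to $x^*$, where $x^*$ is the minimum norm element of $\operatorname{argmin} f$ (i.e. the metric projection of $0$ onto $\operatorname{argmin} f$). Moreover $\|x_k-y_k\|=o(\sqrt{\epsilon_k})$ as $k\to+\infty$, hence $(y_k)$ also converges strongly to $x^*$. Further, as $k\to+\infty$, $$f_k(x_k)-f_k(\overline{x}_k)=o(\epsilon_k),$$ $$f(x_k)-\min f=\mathcal{O}(\epsilon_k),\qquad f(y_k)-\min f=\mathcal{O}(\epsilon_k),$$ $$\|x_k-x_{k-1}\|=o(\sqrt{\epsilon_k}),$$ $$\|\nabla f(x_k)\|=o(\sqrt{\epsilon_k}),\qquad \|\nabla f(y_k)\|=o(\sqrt{\epsilon_k}).$$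
   Context: The coefficients are defined for $k\ge1$ as follows. If $k=1$ or $(1-s\epsilon_{k-1})(1-s\epsilon_k)q_{k-1}q_k=0$, then $b_{k-1}=0$ and $c_k=0$. Otherwise $$b_{k-1}=\frac{(q_{k-1}-s)\left((1-s\epsilon_{k-1})^2q_{k-1}-2s\right)}{(1-s\epsilon_{k-1})(1-s\epsilon_k)q_{k-1}q_k},$$ $$c_k=\frac{2s}{(1-s\epsilon_{k-1})(1-s\epsilon_k)^2q_k}\left(\frac{s}{q_{k-1}}-\frac{s^2\epsilon_k}{q_{k-1}}-s(\epsilon_{k-1}-\epsilon_k)\right).$$ Standing assumption of the paper on the algorithm: $c_k\ge0$ for $k$ big enough and $\lim_{k\to+\infty}c_k=0$. For $k\ge1$, $f_k:\mathcal{H}\to\mathbb{R}$ denotes the strongly convex function $f_k(x)=f(x)+\frac{\epsilon_k}{2}\|x\|^2$, and $\overline{x}_k$ denotes its unique minimizer. *)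

theory Defs
  imports "HOL-Analysis.Analysis" "HOL-Library.Landau_Symbols"
begin

definition argmin_set :: "('a \<Rightarrow> real) \<Rightarrow> 'a set" where
  "argmin_set f = {x. is_arg_min f (\<lambda>_. True) x}"

text \<open>The metric projection of the origin onto \<open>S\<close>. On a nonempty closed convex subset of a
  Hilbert space the minimizer of the norm exists and is unique, so the choice made by
  \<^const>\<open>arg_min\<close> is immaterial. In general the value is unspecified.\<close>

definition min_norm_element :: "'a::real_normed_vector set \<Rightarrow> 'a" where
  "min_norm_element S = arg_min norm (\<lambda>x. x \<in> S)"

definition tikhonov :: "('a::real_normed_vector \<Rightarrow> real) \<Rightarrow> real \<Rightarrow> 'a \<Rightarrow> real" where
  "tikhonov f e x = f x + e / 2 * (norm x)\<^sup>2"

text \<open>For \<open>f\<close> convex and continuous on a Hilbert space and \<open>e > 0\<close>, the regularized function is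
  strongly convex and has exactly one minimizer, which is the value below.\<close>

definition tikhonov_minimizer :: "('a::real_normed_vector \<Rightarrow> real) \<Rightarrow> real \<Rightarrow> 'a" where
  "tikhonov_minimizer f e = arg_min (tikhonov f e) (\<lambda>_. True)"

text \<open>\<open>coeff_b s \<epsilon> q j\<close> is the inertial coefficient \<open>b\<^sub>j\<close> used in step \<open>k = j + 1\<close>. The value
  \<open>\<epsilon> 0\<close> influences neither \<open>coeff_b\<close> nor \<open>coeff_c\<close>, so only \<open>(\<epsilon> k)\<close> for \<open>k \<ge> 1\<close> matters.\<close>

definition coeff_b :: "real \<Rightarrow> (nat \<Rightarrow> real) \<Rightarrow> (nat \<Rightarrow> real) \<Rightarrow> nat \<Rightarrow> real" where
  "coeff_b s \<epsilon> q j =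
    (if j = 0 \<or> (1 - s * \<epsilon> j) * (1 - s * \<epsilon> (j + 1)) * q j * q (j + 1) = 0 then 0
     else (q j - s) * ((1 - s * \<epsilon> j)\<^sup>2 * q j - 2 * s)
          / ((1 - s * \<epsilon> j) * (1 - s * \<epsilon> (j + 1)) * q j * q (j + 1)))"

definition coeff_c :: "real \<Rightarrow> (nat \<Rightarrow> real) \<Rightarrow> (nat \<Rightarrow> real) \<Rightarrow> nat \<Rightarrow> real" where
  "coeff_c s \<epsilon> q k =
    (if k \<le> 1 \<or> (1 - s * \<epsilon> (k - 1)) * (1 - s * \<epsilon> k) * q (k - 1) * q k = 0 then 0
     else 2 * s / ((1 - s * \<epsilon> (k - 1)) * (1 - s * \<epsilon> k)\<^sup>2 * q k)
          * (s / q (k - 1) - s\<^sup>2 * \<epsilon> k / q (k - 1) - s * (\<epsilon> (k - 1) - \<epsilon> k)))"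

end

theory Submission
  imports Defs
begin

text \<open>
  Put \<open>t\<^sub>n = q\<^sub>n / (2 s)\<close> and let \<open>m\<^sub>k\<close> be the minimizer of \<open>f\<^sub>k\<close>. The gradient step inequality for
  \<open>f\<^sub>k\<close>, combined as in Nesterov's method, makes
  \<open>E\<^sub>n = t\<^sub>n\<^sup>2 (f\<^sub>n\<^sub>+\<^sub>1 x\<^sub>n\<^sub>+\<^sub>1 - f\<^sub>n\<^sub>+\<^sub>1 m\<^sub>n\<^sub>+\<^sub>1) + |x\<^sub>n\<^sub>+\<^sub>1 - m\<^sub>n\<^sub>+\<^sub>1 + (t\<^sub>n - 1) (x\<^sub>n\<^sub>+\<^sub>1 - x\<^sub>n)|\<^sup>2 / (2 s)\<close>
  a Lyapunov function with damping of order \<open>1 / t\<^sub>n\<close>: the coefficients satisfy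
  \<open>t\<^sub>n\<^sub>+\<^sub>1 b\<^sub>n - t\<^sub>n \<longlonglongrightarrow> - 3 / 2\<close> and \<open>t\<^sub>n\<^sub>+\<^sub>1 - t\<^sub>n \<le> 3 / 8\<close> eventually, while Nesterov's scheme only needs
  \<open>t\<^sub>n\<^sub>+\<^sub>1 b\<^sub>n = t\<^sub>n - 1\<close> and \<open>t\<^sub>n\<^sub>+\<^sub>1 - t\<^sub>n \<le> 1 / 2\<close>. The terms caused by the movement of \<open>m\<^sub>k\<close>, the change
  of \<open>\<epsilon>\<^sub>k\<close> and the coefficient \<open>c\<^sub>k = O(1 / t\<^sub>k\<^sup>2)\<close> are \<open>o(t\<^sub>n \<epsilon>\<^sub>n)\<close>. Dividing
  \<open>E\<^sub>n\<^sub>+\<^sub>1 \<le> (1 - 1 / (8 t\<^sub>n)) E\<^sub>n + o(t\<^sub>n \<epsilon>\<^sub>n)\<close> by the nondecreasing \<open>t\<^sub>n\<^sup>2 \<epsilon>\<^sub>n\<close> and using that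
  \<open>\<Sum> 1 / t\<^sub>n\<close> diverges gives \<open>E\<^sub>n = o(t\<^sub>n\<^sup>2 \<epsilon>\<^sub>n)\<close>. All estimates follow from this by strong convexity
  and the convergence of \<open>m\<^sub>k\<close> to the minimum norm solution.
\<close>

section \<open>Tikhonov regularization\<close>

lemma norm_sq_convex_comb:
  fixes u v :: "'a::real_inner"
  shows "(norm ((1 - a) *\<^sub>R u + a *\<^sub>R v))\<^sup>2
    = (1 - a) * (norm u)\<^sup>2 + a * (norm v)\<^sup>2 - a * (1 - a) * (norm (u - v))\<^sup>2"
  unfolding power2_norm_eq_inner by (simp add: inner_simps inner_commute[of v u]) algebra

lemma tikhonov_convex_comb:
  fixes f :: "'a::real_inner \<Rightarrow> real"
  assumes "convex_on UNIV f" "0 \<le> a" "a \<le> 1"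
  shows "tikhonov f e ((1 - a) *\<^sub>R u + a *\<^sub>R v)
    \<le> (1 - a) * tikhonov f e u + a * tikhonov f e v - e / 2 * a * (1 - a) * (norm (u - v))\<^sup>2"
proof -
  have "f ((1 - a) *\<^sub>R u + a *\<^sub>R v) \<le> (1 - a) * f u + a * f v"
    using convex_onD[OF assms(1), of a u v] assms by auto
  then show ?thesis
    unfolding tikhonov_def norm_sq_convex_comb by (simp add: algebra_simps diff_divide_distrib add_divide_distrib)
qed

text \<open>Quadratic growth at the minimizer: compare \<open>m\<close> with a point of the segment
  from \<open>m\<close> to \<open>u\<close>, divide by its distance parameter \<open>1 - z\<close>,
  and let \<open>z\<close> tend to 1.\<close>

lemma tikhonov_growth:
  fixes f :: "'a::real_inner \<Rightarrow> real"
  assumes "convex_on UNIV f" and min: "\<And>u. tikhonov f e m \<le> tikhonov f e u"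
  shows "e / 2 * (norm (u - m))\<^sup>2 \<le> tikhonov f e u - tikhonov f e m"
proof (rule field_le_mult_one_interval)
  fix z :: real assume z: "0 < z" "z < 1"
  have "tikhonov f e m \<le> z * tikhonov f e m + (1 - z) * tikhonov f e u
      - e / 2 * (1 - z) * z * (norm (m - u))\<^sup>2"
    using tikhonov_convex_comb[OF assms(1), of "1 - z" e m u] z min order_trans by fastforce
  then have "(1 - z) * (z * (e / 2 * (norm (u - m))\<^sup>2))
      \<le> (1 - z) * (tikhonov f e u - tikhonov f e m)"
    by (simp add: algebra_simps norm_minus_commute)
  then show "z * (e / 2 * (norm (u - m))\<^sup>2) \<le> tikhonov f e u - tikhonov f e m"
    using z by simp
qed

text \<open>Direct method in which strong convexity replaces weak compactness: every minimizing
  sequence is Cauchy, hence converges in norm, and continuity identifies the value of its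
  limit.\<close>

lemma tikhonov_has_minimizer:
  fixes f :: "'a::{real_inner, complete_space} \<Rightarrow> real"
  assumes conv: "convex_on UNIV f" and cont: "continuous_on UNIV f"
    and lower: "\<And>z. c \<le> f z" and e: "e > 0"
  obtains m where "\<And>u. tikhonov f e m \<le> tikhonov f e u"
proof -
  let ?F = "tikhonov f e"
  define I where "I = (INF z. ?F z)"
  have "c \<le> ?F z" for z using lower[of z] e by (simp add: tikhonov_def add_increasing2)
  then have bdd: "bdd_below (range ?F)" by (intro bdd_belowI[of _ c]) auto
  then have I: "I \<le> ?F z" for z unfolding I_def by (intro cINF_lower) auto
  define \<delta> where "\<delta> n = inverse (real (Suc n))" for n
  have "\<exists>z. ?F z < I + \<delta> n" for n
    using cINF_less_iff[of UNIV ?F "I + \<delta> n"] bdd unfolding I_def \<delta>_def by auto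
  then obtain u where u: "\<And>n. ?F (u n) < I + \<delta> n" by metis
  \<comment> \<open>The midpoint of \<open>v\<close> and \<open>w\<close> has value at least
    \<open>I\<close>, so strong convexity bounds their distance by their excess over the
    infimum.\<close>
  have close: "e * (norm (v - w))\<^sup>2 \<le> 4 * (?F v - I + (?F w - I))" for v w
    using tikhonov_convex_comb[OF conv, of "1/2" e v w] I[of "(1 - 1/2) *\<^sub>R v + (1/2) *\<^sub>R w"]
    by (simp add: field_simps)
  have "Cauchy u"
  proof (rule metric_CauchyI)
    fix r :: real assume r: "r > 0"
    then obtain N where N: "\<delta> N < e / 8 * r\<^sup>2"
      using reals_Archimedean[of "e / 8 * r\<^sup>2"] e unfolding \<delta>_def by auto
    have "dist (u m) (u n) < r" if "m \<ge> N" "n \<ge> N" for m n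
    proof -
      have "\<delta> m \<le> \<delta> N" "\<delta> n \<le> \<delta> N"
        using that unfolding \<delta>_def by (simp_all add: le_imp_inverse_le)
      then have "e * (norm (u m - u n))\<^sup>2 < e * r\<^sup>2"
        using close[of "u m" "u n"] u[of m] u[of n] N by simp
      then have "(norm (u m - u n))\<^sup>2 < r\<^sup>2" using e by simp
      then show ?thesis using r by (simp add: dist_norm power_less_imp_less_base)
    qed
    then show "\<exists>M. \<forall>m\<ge>M. \<forall>n\<ge>M. dist (u m) (u n) < r" by blast
  qed
  then obtain m where m: "u \<longlonglongrightarrow> m" using Cauchy_convergent convergent_def by blast
  have "continuous_on UNIV ?F" unfolding tikhonov_def by (intro continuous_intros cont)
  then have "(\<lambda>n. ?F (u n)) \<longlonglongrightarrow> ?F m"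
    using m continuous_on_tendsto_compose[of UNIV ?F u m] by auto
  moreover have "(\<lambda>n. I + \<delta> n) \<longlonglongrightarrow> I"
    using LIMSEQ_inverse_real_of_nat_add unfolding \<delta>_def by auto
  ultimately have "?F m \<le> I" by (rule LIMSEQ_le) (use u less_imp_le in blast)
  then show ?thesis using that[of m] I order_trans by blast
qed

lemma tikhonov_minimizer_le:
  fixes f :: "'a::{real_inner, complete_space} \<Rightarrow> real"
  assumes "convex_on UNIV f" "continuous_on UNIV f" "\<And>z. c \<le> f z" "e > 0"
  shows "tikhonov f e (tikhonov_minimizer f e) \<le> tikhonov f e u"
proof -
  obtain m where "\<And>u. tikhonov f e m \<le> tikhonov f e u"
    using tikhonov_has_minimizer[OF assms] by metis
  then have "is_arg_min (tikhonov f e) (\<lambda>_. True) m"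
    by (auto simp: is_arg_min_def not_less)
  then have "is_arg_min (tikhonov f e) (\<lambda>_. True) (tikhonov_minimizer f e)"
    unfolding tikhonov_minimizer_def arg_min_def by (rule someI)
  then show ?thesis by (auto simp: is_arg_min_def not_less)
qed

section \<open>Dependence of the minimizer on the regularization parameter\<close>

lemma tikhonov_change:
  "tikhonov f d u = tikhonov f e u + (d - e) / 2 * (norm u)\<^sup>2"
  by (simp add: tikhonov_def field_simps)

lemma norm_tikhonov_minimizer_le:
  fixes p :: "'a::real_normed_vector"
  assumes "tikhonov f e m \<le> tikhonov f e p" "f p \<le> f m" "e > 0"
  shows "norm m \<le> norm p"
proof -
  have "e / 2 * (norm m)\<^sup>2 \<le> e / 2 * (norm p)\<^sup>2" using assms(1,2) unfolding tikhonov_def by linarith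
  then have "(norm m)\<^sup>2 \<le> (norm p)\<^sup>2" using assms by (simp only: mult_le_cancel_left_pos half_gt_zero)
  then show ?thesis by (simp add: abs_le_square_iff[symmetric])
qed

text \<open>Quadratic growth at \<open>m\<close> tested with \<open>n\<close>, and minimality of
  \<open>n\<close> tested with \<open>m\<close>: the two regularized functions differ only by a
  multiple of the squared norm, so all values of \<open>f\<close> cancel.\<close>

lemma tikhonov_minimizers_dist:
  fixes f :: "'a::real_inner \<Rightarrow> real"
  assumes "convex_on UNIV f" "0 < d" "d \<le> e"
    and m: "\<And>u. tikhonov f e m \<le> tikhonov f e u" and n: "\<And>u. tikhonov f d n \<le> tikhonov f d u"
  shows "e * (norm (n - m))\<^sup>2 \<le> (e - d) * ((norm n)\<^sup>2 - (norm m)\<^sup>2)"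
    and "(norm (n - m))\<^sup>2 \<le> (norm n)\<^sup>2 - (norm m)\<^sup>2"
proof -
  show main: "e * (norm (n - m))\<^sup>2 \<le> (e - d) * ((norm n)\<^sup>2 - (norm m)\<^sup>2)"
    using tikhonov_growth[OF assms(1) m, of n] n[of m]
    by (simp add: tikhonov_change[of f e _ d] field_simps)
  show "(norm (n - m))\<^sup>2 \<le> (norm n)\<^sup>2 - (norm m)\<^sup>2"
  proof (cases "d = e")
    \<comment> \<open>For equal parameters the first bound gives no sign for the difference of
      squared norms, but it forces \<open>n = m\<close>.\<close>
    case True
    then have "n = m" using main assms by (simp add: mult_le_0_iff)
    then show ?thesis by simp
  next
    case False
    then have "0 \<le> (e - d) * ((norm n)\<^sup>2 - (norm m)\<^sup>2)"
      using main assms by (smt (verit) mult_nonneg_nonneg zero_le_power2)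
    then have "0 \<le> (norm n)\<^sup>2 - (norm m)\<^sup>2"
      using False assms by (simp add: zero_le_mult_iff)
    then have "(e - d) * ((norm n)\<^sup>2 - (norm m)\<^sup>2) \<le> e * ((norm n)\<^sup>2 - (norm m)\<^sup>2)"
      using assms by (intro mult_right_mono) auto
    then have "e * (norm (n - m))\<^sup>2 \<le> e * ((norm n)\<^sup>2 - (norm m)\<^sup>2)" using main by linarith
    then show ?thesis using assms by (subst (asm) mult_le_cancel_left_pos) auto
  qed
qed

text \<open>Factoring the difference of squares lets one factor \<open>norm (n - m)\<close> cancel,
  so the displacement is linear, not of square root order, in the relative change of the
  parameter.\<close>

lemma norm_minimizers_diff_le:
  fixes f :: "'a::real_inner \<Rightarrow> real"
  assumes "convex_on UNIV f" "0 < d" "d \<le> e"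
    and "\<And>u. tikhonov f e m \<le> tikhonov f e u" "\<And>u. tikhonov f d n \<le> tikhonov f d u"
    and "norm m \<le> M" "norm n \<le> M"
  shows "norm (n - m) \<le> 2 * M * ((e - d) / e)"
proof -
  have "(norm n)\<^sup>2 - (norm m)\<^sup>2 = (norm n - norm m) * (norm n + norm m)"
    by (simp add: power2_eq_square algebra_simps)
  also have "\<dots> \<le> norm (n - m) * (2 * M)"
    using norm_triangle_ineq2[of n m] assms by (intro mult_mono) auto
  finally have "e * (norm (n - m))\<^sup>2 \<le> (e - d) * (norm (n - m) * (2 * M))"
    using tikhonov_minimizers_dist(1)[OF assms(1-5)] assms
    by (meson diff_ge_0_iff_ge mult_left_mono order_trans)
  then have *: "norm (n - m) * (e * norm (n - m)) \<le> norm (n - m) * ((e - d) * (2 * M))"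
    unfolding power2_eq_square by (simp only: mult.left_commute mult.assoc)
  have "M \<ge> 0" using assms norm_ge_zero order_trans by blast
  then have "e * norm (n - m) \<le> (e - d) * (2 * M)"
    using * assms by (cases "norm (n - m) = 0") auto
  then show ?thesis using assms by (simp add: field_simps)
qed

text \<open>The norms of the minimizers increase and stay below the norm of every solution. Their
  squares therefore form a Cauchy sequence, which \<open>tikhonov_minimizers_dist\<close> transfers
  to the points themselves. The limit solves the problem and inherits the norm bound.\<close>

lemma tikhonov_minimizers_converge:
  fixes f :: "'a::{real_inner, complete_space} \<Rightarrow> real"
  assumes conv: "convex_on UNIV f" and cont: "continuous_on UNIV f" and ne: "argmin_set f \<noteq> {}"
    and pos: "\<And>k. 0 < e k" and dec: "decseq e" and lim: "e \<longlonglongrightarrow> 0"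
    and m: "\<And>k u. tikhonov f (e k) (m k) \<le> tikhonov f (e k) u"
  shows "m \<longlonglongrightarrow> min_norm_element (argmin_set f)"
    and "min_norm_element (argmin_set f) \<in> argmin_set f"
proof -
  have fm: "f p \<le> f z" if "p \<in> argmin_set f" for p z
    using that by (auto simp: argmin_set_def is_arg_min_def not_less)
  have le: "norm (m k) \<le> norm p" if "p \<in> argmin_set f" for k p
    using norm_tikhonov_minimizer_le[OF m fm[OF that] pos] .
  have d: "(norm (m j - m i))\<^sup>2 \<le> (norm (m j))\<^sup>2 - (norm (m i))\<^sup>2" if "i \<le> j" for i j
    using tikhonov_minimizers_dist(2)[OF conv pos, of j "e i"] decseqD[OF dec that] m by auto
  have inc: "incseq (\<lambda>k. (norm (m k))\<^sup>2)"
    using d unfolding incseq_def by (smt (verit) zero_le_power2)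
  obtain p0 where p0: "p0 \<in> argmin_set f" using ne by auto
  have "(norm (m k))\<^sup>2 \<le> (norm p0)\<^sup>2" for k using le[OF p0] by (simp add: power_mono)
  then have "convergent (\<lambda>k. (norm (m k))\<^sup>2)"
    using inc incseq_convergent[of "\<lambda>k. (norm (m k))\<^sup>2"] convergent_def by metis
  then have C: "Cauchy (\<lambda>k. (norm (m k))\<^sup>2)" by (rule convergent_Cauchy)
  have "Cauchy m"
  proof (rule metric_CauchyI)
    fix r :: real assume r: "r > 0"
    then obtain N where N: "\<And>i j. i \<ge> N \<Longrightarrow> j \<ge> N \<Longrightarrow> \<bar>(norm (m i))\<^sup>2 - (norm (m j))\<^sup>2\<bar> < r\<^sup>2"
      using metric_CauchyD[OF C, of "r\<^sup>2"] by (auto simp: dist_real_def)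
    have *: "dist (m j) (m i) < r" if "N \<le> i" "i \<le> j" for i j
    proof -
      have "(norm (m j - m i))\<^sup>2 < r\<^sup>2" using d[OF that(2)] N[of i j] that by linarith
      then show ?thesis using r by (simp add: dist_norm power_less_imp_less_base)
    qed
    have "dist (m j) (m i) < r" if "N \<le> i" "N \<le> j" for i j
      using *[of i j] *[of j i] that by (metis dist_commute nle_le)
    then show "\<exists>N. \<forall>i\<ge>N. \<forall>j\<ge>N. dist (m i) (m j) < r" by blast
  qed
  then obtain z where z: "m \<longlonglongrightarrow> z" using Cauchy_convergent convergent_def by blast
  have nz: "norm z \<le> norm p" if "p \<in> argmin_set f" for p
    using LIMSEQ_le_const2[OF tendsto_norm[OF z]] le[OF that] by blast
  have "(\<lambda>k. f (m k)) \<longlonglongrightarrow> f z"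
    using z continuous_on_tendsto_compose[OF cont] by auto
  moreover have "(\<lambda>k. f p0 + e k / 2 * (norm p0)\<^sup>2) \<longlonglongrightarrow> f p0 + 0 / 2 * (norm p0)\<^sup>2"
    by (intro tendsto_intros lim)  auto
  moreover have "f (m k) \<le> f p0 + e k / 2 * (norm p0)\<^sup>2" for k
    using m[of k p0] pos[of k] unfolding tikhonov_def
    by (smt (verit) divide_pos_pos mult_nonneg_nonneg zero_le_power2)
  ultimately have "f z \<le> f p0 + 0 / 2 * (norm p0)\<^sup>2" by (blast intro: LIMSEQ_le)
  then have zA: "z \<in> argmin_set f"
    using fm[OF p0] order_trans by (fastforce simp: argmin_set_def is_arg_min_def not_less)
  \<comment> \<open>The midpoint of two distinct solutions of least norm would be a solution of
    smaller norm. This identifies the value chosen by \<open>min_norm_element\<close>.\<close>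
  have uniq: "w = z" if w: "w \<in> argmin_set f" "norm w \<le> norm z" for w
  proof -
    have "f z \<le> f w" "f w \<le> f z" using fm zA w by auto
    let ?h = "(1 - 1/2) *\<^sub>R w + (1/2) *\<^sub>R z"
    \<comment> \<open>Regularization parameter 0 turns the strong convexity inequality into plain
      convexity of \<open>f\<close>.\<close>
    have "f ?h \<le> f z" using tikhonov_convex_comb[OF conv, of "1/2" 0 w z] \<open>f w \<le> f z\<close>
      by (simp add: tikhonov_def)
    then have "?h \<in> argmin_set f"
      using fm[OF zA] order_trans by (fastforce simp: argmin_set_def is_arg_min_def not_less)
    then have "norm z \<le> norm ?h" by (rule nz)
    then have "(norm z)\<^sup>2 \<le> (norm ?h)\<^sup>2" by (intro power_mono) auto
    moreover have "(norm w)\<^sup>2 \<le> (norm z)\<^sup>2" using w by (simp add: power_mono)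
    moreover have "(norm ?h)\<^sup>2 = (norm w)\<^sup>2 / 2 + (norm z)\<^sup>2 / 2 - (norm (w - z))\<^sup>2 / 4"
      unfolding norm_sq_convex_comb by simp
    ultimately have "(norm (w - z))\<^sup>2 \<le> 0" by linarith
    then show ?thesis by simp
  qed
  have "is_arg_min norm (\<lambda>p. p \<in> argmin_set f) z"
    using zA nz by (auto simp: is_arg_min_def not_less)
  then have "is_arg_min norm (\<lambda>p. p \<in> argmin_set f) (min_norm_element (argmin_set f))"
    unfolding min_norm_element_def arg_min_def by (rule someI)
  then have "min_norm_element (argmin_set f) = z"
    using zA by (intro uniq) (auto simp: is_arg_min_def not_less)
  with z zA show "m \<longlonglongrightarrow> min_norm_element (argmin_set f)"
    "min_norm_element (argmin_set f) \<in> argmin_set f" by auto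
qed

section \<open>The gradient step and its Lyapunov function\<close>

lemma gderiv_along_line:
  assumes "GDERIV f (z + t *\<^sub>R d) :> g"
  shows "((\<lambda>t. f (z + t *\<^sub>R d)) has_real_derivative inner g d) (at t)"
proof -
  have "((\<lambda>t. f (z + t *\<^sub>R d)) has_derivative (\<lambda>h. inner (h *\<^sub>R d) g)) (at t)"
    using assms unfolding gderiv_def
    by (intro has_derivative_compose[where f = "\<lambda>t. z + t *\<^sub>R d" and g = f])
      (auto intro!: derivative_eq_intros)
  then show ?thesis
    by (simp add: has_field_derivative_def inner_commute mult.commute[of _ "inner _ _"])
qed

lemma convex_above_tangent:
  assumes conv: "convex_on UNIV f" and grad: "GDERIV f z :> g"
  shows "f z + inner g (w - z) \<le> f w"
proof -
  let ?h = "\<lambda>t. f (z + t *\<^sub>R (w - z))"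
  have "convex_on UNIV ?h"
  proof (rule convex_onI)
    fix a u v :: real assume a: "0 < a" "a < 1"
    have "z + ((1 - a) *\<^sub>R u + a *\<^sub>R v) *\<^sub>R (w - z)
        = (1 - a) *\<^sub>R (z + u *\<^sub>R (w - z)) + a *\<^sub>R (z + v *\<^sub>R (w - z))"
      by (simp add: algebra_simps)
    then show "?h ((1 - a) *\<^sub>R u + a *\<^sub>R v) \<le> (1 - a) * ?h u + a * ?h v"
      using convex_onD[OF conv, of a] a by simp
  qed auto
  moreover have "(?h has_real_derivative inner g (w - z)) (at 0)"
    using gderiv_along_line[of f z 0 "w - z"] grad by simp
  ultimately have "?h 1 - ?h 0 \<ge> inner g (w - z) * (1 - 0)"
    by (intro convex_on_imp_above_tangent[where A = UNIV]) auto
  then show ?thesis by simp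
qed

text \<open>The descent lemma: along the segment, \<open>f\<close> minus its quadratic model has
  nonpositive derivative by Cauchy-Schwarz and the Lipschitz bound.\<close>

lemma lipschitz_gradient_upper:
  assumes grad: "\<And>z. GDERIV f z :> g z" and lip: "L-lipschitz_on UNIV g"
  shows "f (z + d) \<le> f z + inner (g z) d + L / 2 * (norm d)\<^sup>2"
proof -
  let ?h = "\<lambda>t. f (z + t *\<^sub>R d) - t * inner (g z) d - L / 2 * t\<^sup>2 * (norm d)\<^sup>2"
  have "?h 1 \<le> ?h 0"
  proof (rule DERIV_nonpos_imp_nonincreasing[where f = ?h])
    fix t :: real assume t: "0 \<le> t" "t \<le> 1"
    have "(?h has_real_derivative
        inner (g (z + t *\<^sub>R d)) d - inner (g z) d - L * t * (norm d)\<^sup>2) (at t)"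
      by (rule derivative_eq_intros gderiv_along_line grad refl | simp)+
    moreover have "inner (g (z + t *\<^sub>R d)) d - inner (g z) d - L * t * (norm d)\<^sup>2 \<le> 0"
    proof -
      have "inner (g (z + t *\<^sub>R d)) d - inner (g z) d \<le> norm (g (z + t *\<^sub>R d) - g z) * norm d"
        using norm_cauchy_schwarz[of "g (z + t *\<^sub>R d) - g z" d] by (simp add: inner_diff_left)
      also have "\<dots> \<le> (L * norm (t *\<^sub>R d)) * norm d"
        using lipschitz_onD[OF lip, of "z + t *\<^sub>R d" z]
        by (intro mult_right_mono) (auto simp: dist_norm)
      finally show ?thesis using t by (simp add: power2_eq_square mult.assoc)
    qed
    ultimately show "\<exists>y. (?h has_real_derivative y) (at t) \<and> y \<le> 0" by blast
  qed simp
  then show ?thesis by simp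
qed

text \<open>The descent lemma at \<open>y\<close> is joined with the tangent inequality towards
  \<open>u\<close>; the quadratic part is expanded exactly. The point \<open>u\<close> is free
  because the inequality is applied both at the current iterate and at the minimizer.\<close>

lemma tikhonov_gradient_step:
  fixes f :: "'a::real_inner \<Rightarrow> real" and y :: 'a
  assumes conv: "convex_on UNIV f" and grad: "\<And>z. GDERIV f z :> g z"
    and lip: "L-lipschitz_on UNIV g" and "0 \<le> e" "0 \<le> s" "s * (L + e) \<le> 1"
  defines "G \<equiv> g y + e *\<^sub>R y"
  shows "tikhonov f e (y - s *\<^sub>R G) \<le> tikhonov f e u + inner G (y - u) - s / 2 * (norm G)\<^sup>2"
proof -
  have 1: "f (y - s *\<^sub>R G) \<le> f y - s * inner (g y) G + L / 2 * s\<^sup>2 * (norm G)\<^sup>2"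
    using lipschitz_gradient_upper[OF grad lip, of y "- s *\<^sub>R G"] by (simp add: power_mult_distrib)
  have 2: "f y + inner (g y) (u - y) \<le> f u"
    by (rule convex_above_tangent[OF conv grad])
  have 3: "(norm (y - s *\<^sub>R G))\<^sup>2 = (norm y)\<^sup>2 - 2 * s * inner y G + s\<^sup>2 * (norm G)\<^sup>2"
    unfolding power2_norm_eq_inner
    by (simp add: inner_simps inner_commute[of G y] power2_eq_square algebra_simps)
  have 4: "(norm y)\<^sup>2 + 2 * inner y (u - y) \<le> (norm u)\<^sup>2"
    using zero_le_power2[of "norm (u - y)"] unfolding power2_norm_eq_inner
    by (simp add: inner_simps inner_commute[of u y])
  \<comment> \<open>The step size bound absorbs the curvature \<open>L + e\<close> of the
    regularized function, leaving half of the first-order decrease.\<close>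
  have "s * (s * (L + e)) * (norm G)\<^sup>2 \<le> s * 1 * (norm G)\<^sup>2"
    using assms by (intro mult_right_mono mult_left_mono) auto
  then have 5: "L / 2 * s\<^sup>2 * (norm G)\<^sup>2 + e / 2 * s\<^sup>2 * (norm G)\<^sup>2 \<le> s / 2 * (norm G)\<^sup>2"
    by (simp add: field_simps power2_eq_square)
  have 6: "e / 2 * ((norm y)\<^sup>2 + 2 * inner y (u - y)) \<le> e / 2 * (norm u)\<^sup>2"
    using 4 assms by (intro mult_left_mono) auto
  have 7: "inner G (y - u) = inner (g y) (y - u) + e * inner y (y - u)"
    "(norm G)\<^sup>2 = inner (g y) G + e * inner y G"
    unfolding power2_norm_eq_inner G_def by (simp_all add: inner_simps inner_commute[of y "g y"] algebra_simps)
  have 8: "s * (norm G)\<^sup>2 = s * inner (g y) G + e * (s * inner y G)"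
    unfolding 7 by (simp add: algebra_simps)
  show ?thesis
    using 1 2 5 6 8 unfolding tikhonov_def 3 7(1)
    by (simp add: algebra_simps inner_diff_right add_divide_distrib)
qed

section \<open>One accelerated step and its energy balance\<close>

lemma norm_add_sq_le:
  fixes u v :: "'a::real_inner"
  assumes "\<eta> > 0"
  shows "(norm (u + v))\<^sup>2 \<le> (1 + \<eta>) * (norm u)\<^sup>2 + (1 + 1 / \<eta>) * (norm v)\<^sup>2"
proof -
  have "0 \<le> \<eta> * (norm (u - (1 / \<eta>) *\<^sub>R v))\<^sup>2" using assms by simp
  also have "\<dots> = \<eta> * (norm u)\<^sup>2 + (norm v)\<^sup>2 / \<eta> - 2 * inner u v"
    using assms unfolding power2_norm_eq_inner
    by (simp add: inner_simps inner_commute[of v u] field_simps)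
  finally show ?thesis
    unfolding power2_norm_eq_inner by (simp add: inner_simps inner_commute[of v u] algebra_simps)
qed

text \<open>Nesterov's combination: the inequality at \<open>x\<close> gets weight
  \<open>T - 1\<close>, the one at \<open>m\<close> weight 1, and the sum is multiplied by
  \<open>T\<close>. The squared gradient then cancels against the one from expanding the new
  norm.\<close>

lemma accelerated_step:
  fixes F :: "'a::real_inner \<Rightarrow> real"
  assumes s: "s > 0" and T: "T \<ge> 1"
    and dx: "F (y - s *\<^sub>R G) \<le> F x + inner G (y - x) - s / 2 * (norm G)\<^sup>2"
    and dm: "F (y - s *\<^sub>R G) \<le> F m + inner G (y - m) - s / 2 * (norm G)\<^sup>2"
  shows "T\<^sup>2 * (F (y - s *\<^sub>R G) - F m)
      + (norm (T *\<^sub>R (y - s *\<^sub>R G) - (T - 1) *\<^sub>R x - m))\<^sup>2 / (2 * s)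
    \<le> (T\<^sup>2 - T) * (F x - F m) + (norm (x + T *\<^sub>R (y - x) - m))\<^sup>2 / (2 * s)"
proof -
  define W where "W = x + T *\<^sub>R (y - x) - m"
  have W: "T *\<^sub>R (y - s *\<^sub>R G) - (T - 1) *\<^sub>R x - m = W - (s * T) *\<^sub>R G"
    unfolding W_def by (simp add: algebra_simps)
  have "(T - 1) * F (y - s *\<^sub>R G) + F (y - s *\<^sub>R G)
    \<le> (T - 1) * (F x + inner G (y - x) - s / 2 * (norm G)\<^sup>2) + (F m + inner G (y - m) - s / 2 * (norm G)\<^sup>2)"
    using dx dm T by (intro add_mono mult_left_mono) auto
  also have "\<dots> = (T - 1) * F x + F m + inner G W - T * (s / 2 * (norm G)\<^sup>2)"
    unfolding W_def by (simp add: inner_simps field_simps)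
  finally have "T * (T * F (y - s *\<^sub>R G)) \<le> T * ((T - 1) * F x + F m + inner G W - T * (s / 2 * (norm G)\<^sup>2))"
    using T by (intro mult_left_mono) (auto simp: algebra_simps)
  moreover have "(norm (W - (s * T) *\<^sub>R G))\<^sup>2 / (2 * s)
    = (norm W)\<^sup>2 / (2 * s) - T * inner G W + T\<^sup>2 * (s / 2 * (norm G)\<^sup>2)"
    using s unfolding power2_norm_eq_inner
    by (simp add: inner_simps inner_commute[of W G] field_simps power2_eq_square)
  ultimately show ?thesis
    unfolding W unfolding W_def[symmetric] by (simp add: algebra_simps power2_eq_square)
qed

text \<open>The vector entering \<open>accelerated_step\<close> is a convex combination of the old
  energy vector \<open>A\<close> and of \<open>B = x - m\<close>, up to a small multiple of
  \<open>x\<close>. The weight \<open>\<rho>\<close> taken from \<open>A\<close> is the damping; the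
  term in \<open>B\<close> is paid for by quadratic growth, since
  \<open>s * \<tau>\<^sup>2 * e\<close> is large.\<close>

lemma lyapunov_step:
  fixes F :: "'a::real_inner \<Rightarrow> real"
  assumes s: "s > 0" and e: "e > 0" and tau: "\<tau> \<ge> 1" and T: "\<tau> \<le> T" "T \<le> \<tau> + 3 / 8"
    and dx: "F (y - s *\<^sub>R G) \<le> F x + inner G (y - x) - s / 2 * (norm G)\<^sup>2"
    and dm: "F (y - s *\<^sub>R G) \<le> F m + inner G (y - m) - s / 2 * (norm G)\<^sup>2"
    and growth: "e / 2 * (norm (x - m))\<^sup>2 \<le> F x - F m"
    and M: "norm m \<le> M"
    and y: "y = x + b *\<^sub>R (x - x') - c *\<^sub>R x"
    and \<rho>: "T * b = (1 - \<rho>) * (\<tau> - 1)" "3 / 8 \<le> \<rho> * \<tau>" "\<rho> * \<tau> \<le> 1"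
    and C: "T\<^sup>2 * \<bar>c\<bar> \<le> C"
    and big: "32 * (1 + 17 * C\<^sup>2) \<le> s * \<tau>\<^sup>2 * e"
  shows "T\<^sup>2 * (F (y - s *\<^sub>R G) - F m)
      + (norm (T *\<^sub>R (y - s *\<^sub>R G) - (T - 1) *\<^sub>R x - m))\<^sup>2 / (2 * s)
    \<le> (1 - 3 / (16 * \<tau>)) * (\<tau>\<^sup>2 * (F x - F m) + (norm (x - m + (\<tau> - 1) *\<^sub>R (x - x')))\<^sup>2 / (2 * s))
      + 17 * C\<^sup>2 * M\<^sup>2 / (s * \<tau>)"
proof -
  define H where "H = F x - F m"
  define A where "A = x - m + (\<tau> - 1) *\<^sub>R (x - x')"
  define B where "B = x - m"
  define W where "W = x + T *\<^sub>R (y - x) - m"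
  define r where "r = 1 / \<tau>"
  have r: "r > 0" "r \<le> 1" "r * \<tau> = 1" "\<tau> = 1 / r" using tau by (auto simp: r_def)
  have rho: "0 \<le> \<rho>" "3 / 8 * r \<le> \<rho>" "\<rho> \<le> r" "\<rho> \<le> 1"
  proof -
    show a: "3 / 8 * r \<le> \<rho>" "\<rho> \<le> r" using \<rho> tau by (simp_all add: r_def field_simps)
    show "0 \<le> \<rho>" "\<rho> \<le> 1" using a r by linarith+
  qed
  have H: "0 \<le> H" using growth e unfolding H_def
    by (meson half_gt_zero less_eq_real_def mult_nonneg_nonneg order_trans zero_le_power2)
  \<comment> \<open>The factorization of \<open>T * b\<close> is exactly what makes the velocity
    term part of a convex combination.\<close>
  have "W = x - m + (T * b) *\<^sub>R (x - x') - (T * c) *\<^sub>R x"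
    unfolding W_def y by (simp add: algebra_simps)
  also have "\<dots> = ((1 - \<rho>) *\<^sub>R A + \<rho> *\<^sub>R B) + (- (T * c) *\<^sub>R x)"
    unfolding \<rho> A_def B_def by (simp add: algebra_simps)
  finally have W: "W = \<dots>" .
  have comb: "(norm ((1 - \<rho>) *\<^sub>R A + \<rho> *\<^sub>R B))\<^sup>2 \<le> (1 - \<rho>) * (norm A)\<^sup>2 + \<rho> * (norm B)\<^sup>2"
    unfolding norm_sq_convex_comb using rho by simp
  have x: "(norm x)\<^sup>2 \<le> 2 * (norm B)\<^sup>2 + 2 * M\<^sup>2"
  proof -
    have "(norm m)\<^sup>2 \<le> M\<^sup>2" using M by (simp add: power_mono)
    then show ?thesis using norm_add_sq_le[of 1 B m] unfolding B_def by simp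
  qed
  have Tc: "(1 + 16 * \<tau>) * (T * c)\<^sup>2 \<le> 17 * C\<^sup>2 * r"
  proof -
    have "\<bar>T * c\<bar> * \<tau> \<le> \<bar>T * c\<bar> * T" using T by (intro mult_left_mono) auto
    also have "\<dots> \<le> C" using C T tau by (simp add: abs_mult power2_eq_square mult_ac)
    finally have "(\<bar>T * c\<bar> * \<tau>)\<^sup>2 \<le> C\<^sup>2" using tau by (intro power_mono) auto
    then have *: "\<tau>\<^sup>2 * (T * c)\<^sup>2 \<le> C\<^sup>2" by (simp add: power_mult_distrib mult_ac)
    have "(1 + 16 * \<tau>) * (T * c)\<^sup>2 \<le> (17 * \<tau>) * (T * c)\<^sup>2"
      using tau by (intro mult_right_mono) auto
    also have "\<dots> = 17 * r * (\<tau>\<^sup>2 * (T * c)\<^sup>2)" using r(4) tau by (simp add: power2_eq_square)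
    also have "\<dots> \<le> 17 * r * C\<^sup>2" using * r by (intro mult_left_mono) auto
    finally show ?thesis by (simp add: mult_ac)
  qed
  \<comment> \<open>Young's inequality with parameter \<open>1 / (16 * \<tau>)\<close>: isolating
    the \<open>c\<close> term costs only \<open>r / 16\<close>, a fraction of the damping
    \<open>3 / 8 * r\<close>.\<close>
  have "(norm W)\<^sup>2 \<le> (1 + 1 / (16 * \<tau>)) * (norm ((1 - \<rho>) *\<^sub>R A + \<rho> *\<^sub>R B))\<^sup>2
      + (1 + 16 * \<tau>) * (norm (- (T * c) *\<^sub>R x))\<^sup>2"
    using norm_add_sq_le[of "1 / (16 * \<tau>)" "(1 - \<rho>) *\<^sub>R A + \<rho> *\<^sub>R B" "- (T * c) *\<^sub>R x"] tau unfolding W by simp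
  also have "\<dots> = (1 + r / 16) * (norm ((1 - \<rho>) *\<^sub>R A + \<rho> *\<^sub>R B))\<^sup>2
      + (1 + 16 * \<tau>) * (T * c)\<^sup>2 * (norm x)\<^sup>2"
    by (simp add: power_mult_distrib r_def)
  also have "\<dots> \<le> (1 + r / 16) * ((1 - \<rho>) * (norm A)\<^sup>2 + \<rho> * (norm B)\<^sup>2)
      + (17 * C\<^sup>2 * r) * (2 * (norm B)\<^sup>2 + 2 * M\<^sup>2)"
    using r comb Tc x by (intro add_mono mult_mono[OF Tc x] mult_left_mono[OF comb]) auto
  also have "\<dots> \<le> (1 - 3 / 16 * r) * (norm A)\<^sup>2 + (2 * r) * (norm B)\<^sup>2
      + (17 * C\<^sup>2 * r) * (2 * (norm B)\<^sup>2 + 2 * M\<^sup>2)"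
  proof -
    have "(1 + r / 16) * (1 - \<rho>) \<le> (1 + r / 16) * (1 - 3 / 8 * r)"
      using rho r by (intro mult_left_mono) auto
    also have "\<dots> \<le> 1 - 3 / 16 * r" using r by (simp add: algebra_simps)
    finally have 1: "(1 + r / 16) * (1 - \<rho>) * (norm A)\<^sup>2 \<le> (1 - 3 / 16 * r) * (norm A)\<^sup>2"
      by (rule mult_right_mono) simp
    have "(1 + r / 16) * \<rho> \<le> 2 * r" using rho r by (intro mult_mono) auto
    then have 2: "(1 + r / 16) * \<rho> * (norm B)\<^sup>2 \<le> (2 * r) * (norm B)\<^sup>2"
      by (rule mult_right_mono) simp
    show ?thesis using 1 2 by (simp add: distrib_left mult.assoc)
  qed
  also have "\<dots> = (1 - 3 / 16 * r) * (norm A)\<^sup>2 + 2 * r * ((1 + 17 * C\<^sup>2) * (norm B)\<^sup>2)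
      + 34 * C\<^sup>2 * M\<^sup>2 * r"
    by (simp add: algebra_simps)
  also have "\<dots> \<le> (1 - 3 / 16 * r) * (norm A)\<^sup>2 + 2 * r * (s * \<tau>\<^sup>2 * H / 16) + 34 * C\<^sup>2 * M\<^sup>2 * r"
  proof -
    \<comment> \<open>The term in \<open>B\<close> becomes a multiple of the gap \<open>H\<close>;
      after division by \<open>2 * s\<close> it costs \<open>\<tau> * H / 16\<close>.\<close>
    have "(1 + 17 * C\<^sup>2) * (norm B)\<^sup>2 \<le> (s * \<tau>\<^sup>2 * e / 32) * (norm B)\<^sup>2"
      using big by (intro mult_right_mono) auto
    also have "\<dots> = s * \<tau>\<^sup>2 / 16 * (e / 2 * (norm B)\<^sup>2)" by simp
    also have "\<dots> \<le> s * \<tau>\<^sup>2 / 16 * H"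
      using growth s unfolding B_def H_def by (intro mult_left_mono) auto
    finally have "(1 + 17 * C\<^sup>2) * (norm B)\<^sup>2 \<le> s * \<tau>\<^sup>2 * H / 16" by simp
    then show ?thesis using r(1) by (intro add_mono mult_left_mono order_refl) auto
  qed
  finally have "(norm W)\<^sup>2 / (2 * s) \<le> ((1 - 3 / 16 * r) * (norm A)\<^sup>2
      + 2 * r * (s * \<tau>\<^sup>2 * H / 16) + 34 * C\<^sup>2 * M\<^sup>2 * r) / (2 * s)"
    using s by (intro divide_right_mono) auto
  also have "\<dots> = (1 - 3 / 16 * r) * ((norm A)\<^sup>2 / (2 * s)) + \<tau> * H / 16 + 17 * C\<^sup>2 * M\<^sup>2 / (s * \<tau>)"
    using s tau by (simp add: r_def field_simps power2_eq_square)
  finally have W_bound: "(norm W)\<^sup>2 / (2 * s) \<le> \<dots>" .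
  \<comment> \<open>As \<open>T\<close> exceeds \<open>\<tau>\<close> by at most
    \<open>3 / 8\<close>, a surplus \<open>\<tau> / 4 * H\<close> remains: \<open>3 / 16\<close> of
    it is the damping of the gap and \<open>1 / 16\<close> pays for the term in
    \<open>B\<close>.\<close>
  have "(T\<^sup>2 - T) * H \<le> (\<tau>\<^sup>2 - \<tau> / 4) * H"
  proof (rule mult_right_mono)
    have "(T - \<tau>) * (T + \<tau> - 1) \<le> 3 / 8 * (T + \<tau> - 1)" using T tau by (intro mult_right_mono) auto
    then show "T\<^sup>2 - T \<le> \<tau>\<^sup>2 - \<tau> / 4" using T tau by (simp add: power2_eq_square algebra_simps)
  qed (rule H)
  moreover have "T\<^sup>2 * (F (y - s *\<^sub>R G) - F m)
      + (norm (T *\<^sub>R (y - s *\<^sub>R G) - (T - 1) *\<^sub>R x - m))\<^sup>2 / (2 * s)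
    \<le> (T\<^sup>2 - T) * H + (norm W)\<^sup>2 / (2 * s)"
    unfolding H_def W_def using T tau by (intro accelerated_step s dx dm) auto
  moreover have "(1 - 3 / (16 * \<tau>)) * (\<tau>\<^sup>2 * H + (norm A)\<^sup>2 / (2 * s))
    = (1 - 3 / 16 * r) * ((norm A)\<^sup>2 / (2 * s)) + \<tau> * H / 16 + (\<tau>\<^sup>2 - \<tau> / 4) * H"
  proof -
    have "(1 - 3 / (16 * \<tau>)) * (\<tau>\<^sup>2 * H + (norm A)\<^sup>2 / (2 * s))
      = (1 - 3 / 16 * r) * ((norm A)\<^sup>2 / (2 * s)) + \<tau>\<^sup>2 * H - 3 / 16 * (r * \<tau>\<^sup>2) * H"
      by (simp add: r_def distrib_left left_diff_distrib)
    moreover have "r * \<tau>\<^sup>2 = \<tau>" using r(3) by (simp add: power2_eq_square)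
    ultimately show ?thesis by (simp add: left_diff_distrib)
  qed
  ultimately show ?thesis
    using W_bound unfolding H_def[symmetric] A_def[symmetric] by linarith
qed

text \<open>Replaces the reference point \<open>m\<close> by the next minimizer. Young's inequality
  with parameter \<open>1 / (16 * \<tau>)\<close> lowers the damping from \<open>3 / 16\<close> to
  \<open>1 / 8\<close>; the displacement and the change \<open>\<nu>\<close> of the gap enter as
  errors.\<close>

lemma lyapunov_shift:
  fixes z m m' :: "'a::real_inner"
  assumes s: "s > 0" and tau: "\<tau> \<ge> 1" and H: "0 \<le> H" and H': "H' \<le> H + \<nu>" and E: "0 \<le> E" and D: "0 \<le> D"
    and step: "T\<^sup>2 * H + (norm (z - m))\<^sup>2 / (2 * s) \<le> (1 - 3 / (16 * \<tau>)) * E + D"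
  shows "T\<^sup>2 * H' + (norm (z - m'))\<^sup>2 / (2 * s)
    \<le> (1 - 1 / (8 * \<tau>)) * E + (2 * D + T\<^sup>2 * \<nu> + 17 * \<tau> * (norm (m' - m))\<^sup>2 / (2 * s))"
proof -
  define r where "r = 1 / \<tau>"
  have r: "r > 0" "r \<le> 1" using tau by (auto simp: r_def)
  have "(norm (z - m'))\<^sup>2 \<le> (1 + r / 16) * (norm (z - m))\<^sup>2 + (1 + 16 * \<tau>) * (norm (m' - m))\<^sup>2"
    using norm_add_sq_le[of "r / 16" "z - m" "m - m'"] tau by (simp add: r_def norm_minus_commute mult.commute)
  also have "\<dots> \<le> (1 + r / 16) * (norm (z - m))\<^sup>2 + 17 * \<tau> * (norm (m' - m))\<^sup>2"
    using tau by (intro add_left_mono mult_right_mono) auto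
  finally have "(norm (z - m'))\<^sup>2 / (2 * s)
      \<le> ((1 + r / 16) * (norm (z - m))\<^sup>2 + 17 * \<tau> * (norm (m' - m))\<^sup>2) / (2 * s)"
    using s by (intro divide_right_mono) auto
  then have 1: "(norm (z - m'))\<^sup>2 / (2 * s)
      \<le> (1 + r / 16) * ((norm (z - m))\<^sup>2 / (2 * s)) + 17 * \<tau> * (norm (m' - m))\<^sup>2 / (2 * s)"
    by (simp add: add_divide_distrib)
  have "T\<^sup>2 * H' \<le> T\<^sup>2 * (H + \<nu>)" using H' by (intro mult_left_mono) auto
  moreover have "1 * (T\<^sup>2 * H) \<le> (1 + r / 16) * (T\<^sup>2 * H)" using H r by (intro mult_right_mono) auto
  ultimately have 2: "T\<^sup>2 * H' \<le> (1 + r / 16) * (T\<^sup>2 * H) + T\<^sup>2 * \<nu>"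
    by (simp add: algebra_simps)
  have "(1 + r / 16) * (T\<^sup>2 * H + (norm (z - m))\<^sup>2 / (2 * s)) \<le> (1 + r / 16) * ((1 - 3 / (16 * \<tau>)) * E + D)"
    using step r by (intro mult_left_mono) auto
  also have "\<dots> = ((1 + r / 16) * (1 - 3 / 16 * r)) * E + (1 + r / 16) * D"
    by (simp add: r_def algebra_simps add_divide_distrib)
  also have "\<dots> \<le> (1 - 1 / 8 * r) * E + 2 * D"
  proof (intro add_mono mult_right_mono E D)
    show "(1 + r / 16) * (1 - 3 / 16 * r) \<le> 1 - 1 / 8 * r" using r by (simp add: algebra_simps)
    show "1 + r / 16 \<le> 2" using r by simp
  qed
  finally show ?thesis using 1 2 by (simp add: r_def distrib_left)
qed

section \<open>Scalar recursions with non-summable damping\<close>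

lemma damped_recursion_tendsto_zero:
  fixes G a \<delta> :: "nat \<Rightarrow> real"
  assumes G: "\<forall>\<^sub>F n in sequentially. 0 \<le> G n" and a: "\<forall>\<^sub>F n in sequentially. 0 \<le> a n \<and> a n \<le> 1"
    and rec: "\<forall>\<^sub>F n in sequentially. G (Suc n) \<le> (1 - a n) * G n + a n * \<delta> n"
    and div: "\<not> summable a" and \<delta>: "\<delta> \<longlonglongrightarrow> 0"
  shows "G \<longlonglongrightarrow> 0"
proof (rule order_tendstoI)
  fix r :: real assume "r < 0"
  show "\<forall>\<^sub>F n in sequentially. r < G n" using G by eventually_elim (use \<open>r < 0\<close> in simp)
next
  fix r :: real assume r: "0 < r"
  have "\<forall>\<^sub>F n in sequentially. \<delta> n < r / 2" using \<delta> r by (intro order_tendstoD) auto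
  with G a rec have "\<forall>\<^sub>F n in sequentially. 0 \<le> G n \<and> 0 \<le> a n \<and> a n \<le> 1
      \<and> G (Suc n) - r / 2 \<le> (1 - a n) * (G n - r / 2)"
  proof eventually_elim
    case (elim n)
    then have "a n * \<delta> n \<le> a n * (r / 2)" by (intro mult_left_mono) auto
    with elim show ?case by (simp add: algebra_simps diff_divide_distrib)
  qed
  then obtain N where N: "\<And>n. n \<ge> N \<Longrightarrow> 0 \<le> G n \<and> 0 \<le> a n \<and> a n \<le> 1
      \<and> G (Suc n) - r / 2 \<le> (1 - a n) * (G n - r / 2)"
    unfolding eventually_sequentially by blast
  define S where "S n = (\<Sum>i<n. a (i + N))" for n
  \<comment> \<open>Once \<open>\<delta>\<close> is below \<open>r / 2\<close>, the excess over
    \<open>r / 2\<close> contracts by \<open>1 - a n \<le> exp (- a n)\<close>. The right side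
    carries \<open>G N\<close>, not \<open>G N - r / 2\<close>, so that it is nonnegative and this
    bound may be multiplied in.\<close>
  have bound: "G (n + N) - r / 2 \<le> G N * exp (- S n)" for n
  proof (induction n)
    case 0
    then show ?case using r by (simp add: S_def)
  next
    case (Suc n)
    have "G (Suc n + N) - r / 2 \<le> (1 - a (n + N)) * (G (n + N) - r / 2)" using N[of "n + N"] by simp
    also have "\<dots> \<le> (1 - a (n + N)) * (G N * exp (- S n))"
      using Suc N[of "n + N"] by (intro mult_left_mono) auto
    also have "\<dots> \<le> exp (- a (n + N)) * (G N * exp (- S n))"
      using exp_ge_add_one_self[of "- a (n + N)"] N[of N] by (intro mult_right_mono) auto
    also have "\<dots> = G N * exp (- S (Suc n))" by (simp add: S_def exp_add[symmetric] exp_minus exp_diff field_simps)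
    finally show ?case .
  qed
  have "\<not> summable (\<lambda>i. a (i + N))" using div summable_iff_shift[of a N] by simp
  \<comment> \<open>Beyond this threshold \<open>exp (S n) \<ge> 1 + S n\<close> exceeds
    \<open>2 * G N / r\<close>, which pushes the decaying term below \<open>r / 2\<close>.\<close>
  then obtain n0 where n0: "2 * G N / r < S n0"
    using summableI_nonneg_bounded[of "\<lambda>i. a (i + N)" "2 * G N / r"] N
    unfolding S_def by (meson le_add2 not_le)
  have "G (n + N) < r" if "n \<ge> n0" for n
  proof -
    have "S n0 \<le> S n" unfolding S_def using that N by (intro sum_mono2) auto
    then have "G N * 2 / r < 1 + S n" using n0 by (simp add: mult.commute)
    also have "\<dots> \<le> exp (S n)" by (rule exp_ge_add_one_self)
    finally have "G N * exp (- S n) < r / 2" using r by (simp add: exp_minus field_simps)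
    then show ?thesis using bound[of n] by simp
  qed
  then show "\<forall>\<^sub>F n in sequentially. G n < r"
    unfolding eventually_sequentially by (metis le_add_diff_inverse2 le_diff_conv2 add_leD2)
qed

text \<open>Increments at most 1 keep \<open>t\<close> below a linear function, so the harmonic
  series is a lower bound up to a constant.\<close>

lemma not_summable_inverse_linear_growth:
  fixes t :: "nat \<Rightarrow> real"
  assumes ev: "\<forall>\<^sub>F n in sequentially. 0 < t n \<and> t (Suc n) \<le> t n + 1"
  shows "\<not> summable (\<lambda>n. 1 / (8 * t n))"
proof
  assume sm: "summable (\<lambda>n. 1 / (8 * t n))"
  obtain N where N: "\<And>n. n \<ge> N \<Longrightarrow> 0 < t n \<and> t (Suc n) \<le> t n + 1"
    using ev unfolding eventually_sequentially by blast
  define c where "c = max 1 (t N)"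
  have t: "t (n + N) \<le> c * real (Suc n)" for n
  proof (induction n)
    case (Suc n)
    then have "t (Suc n + N) \<le> c * real (Suc n) + 1" using N[of "n + N"] by simp
    also have "\<dots> \<le> c * real (Suc (Suc n))" by (simp add: c_def algebra_simps)
    finally show ?case .
  qed (simp add: c_def)
  have "summable (\<lambda>n. 8 * c * (1 / (8 * t (n + N))))"
    using sm by (intro summable_mult) (simp add: summable_iff_shift[of "\<lambda>n. 1 / (8 * t n)"])
  then have "summable (\<lambda>n. inverse (real (Suc n)))"
  proof (rule summable_comparison_test'[where N = 0])
    fix n
    show "norm (inverse (real (Suc n))) \<le> 8 * c * (1 / (8 * t (n + N)))"
      using t[of n] N[of "n + N"] by (simp add: field_simps)
  qed
  then show False
    unfolding summable_Suc_iff[of "\<lambda>n. inverse (real n)"] using not_summable_harmonic by blast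
qed

section \<open>Asymptotics of the coefficients\<close>

text \<open>Separates the single term of order \<open>Q\<close> from the bounded ones. With
  \<open>u\<close> and \<open>v\<close> tending to 1 and \<open>Q\<close> to infinity, the latter
  tend to -1/2, -1 and 0.\<close>

lemma coeff_b_expansion:
  fixes Q Q' u v s :: real
  assumes "Q > 0" "Q' > 0" "u > 0" "v > 0" "s > 0"
  shows "Q' / (2 * s) * ((Q - s) * (u\<^sup>2 * Q - 2 * s) / (u * v * Q * Q'))
    = Q * u / (2 * s * v) - u / (2 * v) - 1 / (u * v) + s / (u * v * Q)"
proof -
  have "Q' / (2 * s) * ((Q - s) * (u\<^sup>2 * Q - 2 * s) / (u * v * Q * Q'))
      = (Q - s) * (u\<^sup>2 * Q - 2 * s) / (2 * s * u * v * Q)"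
    using assms by simp
  also have "\<dots> = (Q * (u * u * Q) - s * (u * u * Q) - 2 * s * Q + 2 * s * s) / (2 * s * u * v * Q)"
    by (simp add: power2_eq_square algebra_simps)
  also have "\<dots> = Q * (u * u * Q) / (2 * s * u * v * Q) - s * (u * u * Q) / (2 * s * u * v * Q)
      - 2 * s * Q / (2 * s * u * v * Q) + 2 * s * s / (2 * s * u * v * Q)"
    by (simp only: add_divide_distrib diff_divide_distrib)
  also have "\<dots> = Q * u / (2 * s * v) - u / (2 * v) - 1 / (u * v) + s / (u * v * Q)"
    using assms by (simp add: mult_ac)
  finally show ?thesis .
qed

text \<open>The conditions on \<open>q\<close> are stated eventually because only asymptotic
  conclusions are drawn; this absorbs the starting indices.\<close>

locale inertial_parameters =
  fixes \<epsilon> q :: "nat \<Rightarrow> real" and s :: real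
  assumes eps_antimono: "antimono_on {1..} \<epsilon>"
    and eps_pos: "k \<ge> 1 \<Longrightarrow> \<epsilon> k > 0"
    and eps_lim: "\<epsilon> \<longlonglongrightarrow> 0"
    and s_pos: "0 < s"
    and q_growth: "\<forall>\<^sub>F k in sequentially.
      (1 - s * \<epsilon> (k + 1))\<^sup>2 * (q (k + 1))\<^sup>2 - (1 - s * \<epsilon> k)\<^sup>2 * (q k)\<^sup>2
          - 2 * s * q (k + 1) + s * (1 - s * \<epsilon> k)\<^sup>2 * q k \<le> 0"
    and q_pos: "\<forall>\<^sub>F k in sequentially. q k > 0"
    and q2eps_mono: "\<forall>\<^sub>F k in sequentially. (q k)\<^sup>2 * \<epsilon> k \<le> (q (k + 1))\<^sup>2 * \<epsilon> (k + 1)"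
    and q2eps_lim: "filterlim (\<lambda>k. (q k)\<^sup>2 * \<epsilon> k) at_top sequentially"
    and eps_diff_lim: "(\<lambda>k. q k * (\<epsilon> k - \<epsilon> (k + 1)) / \<epsilon> k) \<longlonglongrightarrow> 0"
begin

lemma eps_Suc_le: "k \<ge> 1 \<Longrightarrow> \<epsilon> (Suc k) \<le> \<epsilon> k"
  using eps_antimono by (auto simp: monotone_on_def)

lemma q_at_top: "filterlim q at_top sequentially"
  unfolding filterlim_at_top_ge[where c = 0]
proof (intro allI impI)
  fix Z :: real assume Z: "Z \<ge> 0"
  have "\<forall>\<^sub>F k in sequentially. Z\<^sup>2 \<le> (q k)\<^sup>2 * \<epsilon> k"
    using q2eps_lim unfolding filterlim_at_top by blast
  moreover have "\<forall>\<^sub>F k in sequentially. \<epsilon> k < 1" using eps_lim by (rule order_tendstoD) simp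
  ultimately show "\<forall>\<^sub>F k in sequentially. Z \<le> q k" using q_pos
  proof eventually_elim
    case (elim k)
    have "(q k)\<^sup>2 * \<epsilon> k \<le> (q k)\<^sup>2 * 1" using elim by (intro mult_left_mono) auto
    then have "Z\<^sup>2 \<le> (q k)\<^sup>2" using elim by linarith
    then show ?case by (rule power2_le_imp_le) (use elim in simp)
  qed
qed

lemma q_mono: "\<forall>\<^sub>F k in sequentially. q k \<le> q (Suc k)"
  using q2eps_mono q_pos eventually_sequentially_Suc[THEN iffD2, OF q_pos] eventually_ge_at_top[of 1]
proof eventually_elim
  case (elim k)
  have "(q k)\<^sup>2 * \<epsilon> k \<le> (q (Suc k))\<^sup>2 * \<epsilon> (Suc k)" using elim by simp
  also have "\<dots> \<le> (q (Suc k))\<^sup>2 * \<epsilon> k" using elim eps_Suc_le by (intro mult_left_mono) auto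
  finally have "(q k)\<^sup>2 \<le> (q (Suc k))\<^sup>2" using eps_pos[of k] elim by simp
  then show ?case by (rule power2_le_imp_le) (use elim in simp)
qed

text \<open>With \<epsilon> replaced by 0 the growth condition bounds the increment by about
  \<open>s / 2\<close> for large \<open>q\<close>. The slack up to \<open>3 / 4 * s\<close> absorbs
  the factors tending to 1, and it is the increment \<open>3 / 8\<close> for
  \<open>q k / (2 * s)\<close>.\<close>

lemma q_increment_le: "\<forall>\<^sub>F k in sequentially. q (Suc k) \<le> q k + 3 / 4 * s"
proof -
  have "(\<lambda>k. (1 - s * \<epsilon> k)\<^sup>2) \<longlonglongrightarrow> (1 - s * 0)\<^sup>2" by (intro tendsto_intros eps_lim)
  then have "\<forall>\<^sub>F k in sequentially. 9 / 10 < (1 - s * \<epsilon> k)\<^sup>2" by (rule order_tendstoD) simp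
  moreover have "\<forall>\<^sub>F k in sequentially. s * \<epsilon> k < 1"
    using tendsto_mult_left[OF eps_lim, of s] by (intro order_tendstoD) auto
  moreover have "\<forall>\<^sub>F k in sequentially. 8 * s \<le> q k" using q_at_top unfolding filterlim_at_top by blast
  ultimately show ?thesis using q_growth eventually_ge_at_top[of 1] q_mono
  proof eventually_elim
    case (elim k)
    define w where "w = (1 - s * \<epsilon> k)\<^sup>2"
    have pos: "0 < \<epsilon> k" "\<epsilon> (Suc k) \<le> \<epsilon> k" using eps_pos eps_Suc_le elim by auto
    then have *: "s * \<epsilon> (Suc k) \<le> s * \<epsilon> k" "0 \<le> s * \<epsilon> k" using s_pos by auto
    have w: "9 / 10 < w" "w \<le> (1 - s * \<epsilon> (Suc k))\<^sup>2" "w \<le> 1"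
      using elim * unfolding w_def by (auto intro!: power_mono power_le_one)
    show ?case
    proof (rule ccontr)
      define d where "d = q (Suc k) - q k"
      assume "\<not> ?case"
      then have d: "3 / 4 * s < d" by (simp add: d_def)
      \<comment> \<open>The later weight is at least \<open>w\<close>, so both squares can be given
        the weight \<open>w\<close> and their difference factored.\<close>
      have "w * (q (Suc k))\<^sup>2 \<le> (1 - s * \<epsilon> (Suc k))\<^sup>2 * (q (Suc k))\<^sup>2"
        using w by (intro mult_right_mono) auto
      then have "w * (q (Suc k))\<^sup>2 - w * (q k)\<^sup>2 \<le> 2 * s * q (Suc k) - s * w * q k"
        using elim(4) unfolding w_def by simp
      then have "d * (2 * (w * q k) + w * d - 2 * s) \<le> s * (2 * q k - w * q k)"
        unfolding d_def by (simp add: power2_eq_square algebra_simps)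
      moreover define Y where "Y = 2 * (w * q k) + w * d - 2 * s"
      ultimately have 1: "d * Y \<le> s * (2 * q k - w * q k)" by simp
      have wq: "9 / 10 * q k \<le> w * q k" "0 \<le> w * d"
        using w elim d s_pos by (auto intro!: mult_right_mono mult_nonneg_nonneg)
      then have "0 \<le> Y" using elim(3) s_pos unfolding Y_def by linarith
      then have "(3 / 4 * s) * Y \<le> d * Y" using d by (intro mult_right_mono) auto
      with 1 have "s * (3 / 4 * Y) \<le> s * (2 * q k - w * q k)"
        unfolding mult.left_commute[of s "3 / 4"] mult.assoc by linarith
      then have "3 / 4 * Y \<le> 2 * q k - w * q k"
        using s_pos by (simp only: mult_le_cancel_left_pos)
      \<comment> \<open>With \<open>w > 9 / 10\<close> the inequality would give
        \<open>q k \<le> 6 * s\<close>, against \<open>8 * s \<le> q k\<close>.\<close>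
      then show False using wq elim(3) s_pos unfolding Y_def by argo
    qed
  qed
qed

lemma q_eps_diff_tendsto: "(\<lambda>k. q k * (\<epsilon> k - \<epsilon> (Suc k))) \<longlonglongrightarrow> 0"
proof -
  have "(\<lambda>k. (q k * (\<epsilon> k - \<epsilon> (k + 1)) / \<epsilon> k) * \<epsilon> k) \<longlonglongrightarrow> 0 * 0"
    by (intro tendsto_mult eps_diff_lim eps_lim)
  moreover have "\<forall>\<^sub>F k in sequentially.
      (q k * (\<epsilon> k - \<epsilon> (k + 1)) / \<epsilon> k) * \<epsilon> k = q k * (\<epsilon> k - \<epsilon> (Suc k))"
    using eventually_ge_at_top[of 1] by eventually_elim (use eps_pos in force)
  ultimately show ?thesis by (simp add: Lim_transform_eventually)
qed

lemma eps_Suc_tendsto: "(\<lambda>k. \<epsilon> (Suc k)) \<longlonglongrightarrow> 0"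
  using eps_lim by (rule LIMSEQ_Suc)

lemma s_eps_small: "\<forall>\<^sub>F k in sequentially. 1 / 2 < 1 - s * \<epsilon> k"
  using tendsto_diff[OF tendsto_const tendsto_mult_left[OF eps_lim, of s], of 1]
  by (intro order_tendstoD) auto

text \<open>In \<open>coeff_b_expansion\<close> the leading term differs from
  \<open>q k / (2 * s)\<close> by a multiple of
  \<open>q k * (\<epsilon> k - \<epsilon> (Suc k))\<close>, which vanishes; the bounded terms leave
  -1/2 - 1.\<close>

lemma coeff_b_asymptotics:
  "(\<lambda>k. q (Suc k) / (2 * s) * coeff_b s \<epsilon> q k - q k / (2 * s)) \<longlonglongrightarrow> - 3 / 2"
proof -
  let ?u = "\<lambda>k. 1 - s * \<epsilon> k"
  let ?v = "\<lambda>k. 1 - s * \<epsilon> (Suc k)"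
  have u: "?u \<longlonglongrightarrow> 1 - s * 0" and v: "?v \<longlonglongrightarrow> 1 - s * 0"
    by (intro tendsto_intros eps_lim eps_Suc_tendsto)+
  have "(\<lambda>k. inverse (q k)) \<longlonglongrightarrow> 0"
    by (rule tendsto_inverse_0_at_top[OF q_at_top])
  then have "(\<lambda>k. - (q k * (\<epsilon> k - \<epsilon> (Suc k))) / (2 * ?v k) - ?u k / (2 * ?v k) - 1 / (?u k * ?v k)
      + s * inverse (q k) / (?u k * ?v k)) \<longlonglongrightarrow>
      - 0 / (2 * (1 - s * 0)) - (1 - s * 0) / (2 * (1 - s * 0)) - 1 / ((1 - s * 0) * (1 - s * 0))
      + s * 0 / ((1 - s * 0) * (1 - s * 0))"
    by (intro tendsto_intros u v q_eps_diff_tendsto) auto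
  then have lim: "(\<lambda>k. - (q k * (\<epsilon> k - \<epsilon> (Suc k))) / (2 * ?v k) - ?u k / (2 * ?v k)
      - 1 / (?u k * ?v k) + s * inverse (q k) / (?u k * ?v k)) \<longlonglongrightarrow> - 3 / 2" by simp
  show ?thesis
  proof (rule tendsto_cong[THEN iffD1, OF _ lim])
    show "\<forall>\<^sub>F k in sequentially. - (q k * (\<epsilon> k - \<epsilon> (Suc k))) / (2 * ?v k) - ?u k / (2 * ?v k)
      - 1 / (?u k * ?v k) + s * inverse (q k) / (?u k * ?v k)
      = q (Suc k) / (2 * s) * coeff_b s \<epsilon> q k - q k / (2 * s)"
      using s_eps_small eventually_sequentially_Suc[THEN iffD2, OF s_eps_small]
        q_pos eventually_sequentially_Suc[THEN iffD2, OF q_pos] eventually_ge_at_top[of 1]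
    proof eventually_elim
      case (elim k)
      define u v where "u = ?u k" and "v = ?v k"
      have uv: "u > 0" "v > 0" "q k > 0" "q (Suc k) > 0" using elim by (auto simp: u_def v_def)
      have b: "q (Suc k) / (2 * s) * coeff_b s \<epsilon> q k
          = q (Suc k) / (2 * s) * ((q k - s) * (u\<^sup>2 * q k - 2 * s) / (u * v * q k * q (Suc k)))"
        using uv elim by (simp add: coeff_b_def u_def[symmetric] v_def[symmetric])
      have split: "q k * u / (2 * s * v) = q k / (2 * s) + q k * (u - v) / (2 * s * v)"
        using uv s_pos by (simp add: field_simps)
      have uv_diff: "u - v = - (s * (\<epsilon> k - \<epsilon> (Suc k)))"
        by (simp add: u_def v_def algebra_simps)
      have "q k * (u - v) / (2 * s * v) = - (q k * (\<epsilon> k - \<epsilon> (Suc k))) / (2 * v)"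
        unfolding uv_diff using s_pos by simp
      moreover have "s * inverse (q k) / (u * v) = s / (u * v * q k)"
        by (simp add: divide_inverse mult_ac)
      ultimately show ?case
        unfolding b u_def[symmetric] v_def[symmetric]
        using split coeff_b_expansion[of "q k" "q (Suc k)" u v s] uv s_pos by linarith
    qed
  qed
qed

text \<open>After rescaling, the coefficient is \<open>D / (2 * (u * v\<^sup>2))\<close>; the
  numerator is at most 3 in absolute value and the denominator at least
  \<open>1 / 4\<close>.\<close>

lemma coeff_c_bound: "\<forall>\<^sub>F k in sequentially. (q (Suc k) / (2 * s))\<^sup>2 * \<bar>coeff_c s \<epsilon> q (Suc k)\<bar> \<le> 12"
proof -
  have "\<forall>\<^sub>F k in sequentially. q k * (\<epsilon> k - \<epsilon> (Suc k)) < 1 / 2"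
    using q_eps_diff_tendsto by (rule order_tendstoD) simp
  moreover have "\<forall>\<^sub>F k in sequentially. s \<le> q k" using q_at_top unfolding filterlim_at_top by blast
  ultimately show ?thesis
    using s_eps_small eventually_sequentially_Suc[THEN iffD2, OF s_eps_small]
      q_pos q_mono q_increment_le eventually_ge_at_top[of 1]
  proof eventually_elim
    case (elim k)
    define u v where "u = 1 - s * \<epsilon> k" and "v = 1 - s * \<epsilon> (Suc k)"
    define D where "D = v * (q (Suc k) / q k) - q (Suc k) * (\<epsilon> k - \<epsilon> (Suc k))"
    have q: "q k > 0" "q (Suc k) > 0" "q (Suc k) \<le> 2 * q k" using elim s_pos by auto
    have uv: "1 / 2 < u" "1 / 2 < v" "v \<le> 1"
      using elim s_pos eps_pos[of "Suc k"] by (auto simp: u_def v_def)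
    have diff: "0 \<le> \<epsilon> k - \<epsilon> (Suc k)" using eps_Suc_le elim by simp
    have c: "coeff_c s \<epsilon> q (Suc k)
        = 2 * s / (u * v\<^sup>2 * q (Suc k)) * (s / q k - s\<^sup>2 * \<epsilon> (Suc k) / q k - s * (\<epsilon> k - \<epsilon> (Suc k)))"
      using uv q elim by (simp add: coeff_c_def u_def[symmetric] v_def[symmetric])
    define X where "X = v / q k - (\<epsilon> k - \<epsilon> (Suc k))"
    have "s / q k - s\<^sup>2 * \<epsilon> (Suc k) / q k = s * (v / q k)"
      using q by (simp add: v_def field_simps power2_eq_square)
    then have "s / q k - s\<^sup>2 * \<epsilon> (Suc k) / q k - s * (\<epsilon> k - \<epsilon> (Suc k)) = s * X"
      unfolding X_def by (simp add: right_diff_distrib)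
    then have "(q (Suc k) / (2 * s))\<^sup>2 * coeff_c s \<epsilon> q (Suc k) = q (Suc k) * X / (2 * (u * v\<^sup>2))"
      unfolding c using q s_pos by (simp add: power2_eq_square)
    also have "q (Suc k) * X = D" by (simp add: X_def D_def right_diff_distrib mult.commute)
    finally have eq: "(q (Suc k) / (2 * s))\<^sup>2 * coeff_c s \<epsilon> q (Suc k) = D / (2 * (u * v\<^sup>2))" .
    have "1 / 2 * (1 / 2)\<^sup>2 \<le> u * v\<^sup>2" using uv by (intro mult_mono power_mono) auto
    then have den: "1 / 4 \<le> 2 * (u * v\<^sup>2)" by (simp add: power2_eq_square)
    have "v * (q (Suc k) / q k) \<le> 1 * 2" using uv q by (intro mult_mono) (auto simp: field_simps)
    moreover have "0 \<le> v * (q (Suc k) / q k)" using uv q by simp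
    moreover have "0 \<le> q (Suc k) * (\<epsilon> k - \<epsilon> (Suc k))" using q diff by simp
    moreover have "q (Suc k) * (\<epsilon> k - \<epsilon> (Suc k)) \<le> 2 * q k * (\<epsilon> k - \<epsilon> (Suc k))"
      using q diff by (intro mult_right_mono) auto
    ultimately have "\<bar>D\<bar> \<le> 3" using elim unfolding D_def by (simp add: abs_le_iff)
    then have "\<bar>D\<bar> / (2 * (u * v\<^sup>2)) \<le> 3 / (1 / 4)" using den by (intro frac_le) auto
    moreover have "(q (Suc k) / (2 * s))\<^sup>2 * \<bar>coeff_c s \<epsilon> q (Suc k)\<bar> = \<bar>D\<bar> / (2 * (u * v\<^sup>2))"
      using arg_cong[OF eq, of abs] uv by (simp add: abs_mult)
    ultimately show ?case by simp
  qed
qed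

end

section \<open>Convergence of the algorithm\<close>

lemma eventually_le_smallo:
  fixes g h :: "nat \<Rightarrow> real"
  assumes "\<forall>\<^sub>F k in sequentially. \<bar>f k\<bar> \<le> h k" "h \<in> o(g)"
  shows "f \<in> o(g)"
proof -
  have "f \<in> O(h)"
    by (rule bigoI[where c = 1]) (use assms(1) in eventually_elim, auto)
  then show ?thesis using assms(2) by (rule landau_o.big_small_trans)
qed

lemma cmult_smallo:
  fixes g h :: "nat \<Rightarrow> real"
  assumes "h \<in> o(g)"
  shows "(\<lambda>k. c * h k) \<in> o(g)"
  using assms by (cases "c = 0") auto

text \<open>The recursions are indexed by \<open>Suc n\<close>, so that predecessors appear without
  truncated subtraction.\<close>

locale tikhonov_inertial = inertial_parameters \<epsilon> q s
  for \<epsilon> q :: "nat \<Rightarrow> real" and s :: real +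
  fixes f :: "'a::{real_inner, complete_space} \<Rightarrow> real" and g :: "'a \<Rightarrow> 'a" and L :: real
    and x y :: "nat \<Rightarrow> 'a"
  assumes f_convex: "convex_on UNIV f"
    and f_gradient: "GDERIV f z :> g z"
    and g_lipschitz: "L-lipschitz_on UNIV g"
    and argmin_nonempty: "argmin_set f \<noteq> {}"
    and step_size: "\<forall>\<^sub>F k in sequentially. s * (L + \<epsilon> k) \<le> 1"
    and y_step: "y (Suc n) = x (Suc n) + coeff_b s \<epsilon> q n *\<^sub>R (x (Suc n) - x n)
        - coeff_c s \<epsilon> q (Suc n) *\<^sub>R x (Suc n)"
    and x_step: "x (Suc (Suc n)) = y (Suc n) - s *\<^sub>R (g (y (Suc n)) + \<epsilon> (Suc n) *\<^sub>R y (Suc n))"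
begin

definition t where "t n = q n / (2 * s)"
definition m where "m k = tikhonov_minimizer f (\<epsilon> k)"
definition p where "p = min_norm_element (argmin_set f)"
definition gap where "gap k = tikhonov f (\<epsilon> k) (x k) - tikhonov f (\<epsilon> k) (m k)"
text \<open>The weight has index \<open>n\<close> because \<open>accelerated_step\<close> produces
  \<open>x (Suc n)\<close> with \<open>T = t n\<close>; the vector inside the norm is its output
  \<open>T *\<^sub>R x (Suc n) - (T - 1) *\<^sub>R x n - m (Suc n)\<close> rearranged.\<close>

definition energy where "energy n = (t n)\<^sup>2 * gap (Suc n)
  + (norm (x (Suc n) - m (Suc n) + (t n - 1) *\<^sub>R (x (Suc n) - x n)))\<^sup>2 / (2 * s)"
definition scale where "scale n = (t n)\<^sup>2 * \<epsilon> n"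

lemma f_continuous: "continuous_on UNIV f"
  using f_gradient unfolding gderiv_def
  by (meson continuous_at_imp_continuous_on has_derivative_continuous)

lemma argmin_le: "z \<in> argmin_set f \<Longrightarrow> f z \<le> f u"
  by (auto simp: argmin_set_def is_arg_min_def not_less)

lemma m_le: "k \<ge> 1 \<Longrightarrow> tikhonov f (\<epsilon> k) (m k) \<le> tikhonov f (\<epsilon> k) u"
  using argmin_nonempty argmin_le tikhonov_minimizer_le[OF f_convex f_continuous _ eps_pos]
  unfolding m_def by blast

lemma m_tendsto: "m \<longlonglongrightarrow> p" and p_argmin: "p \<in> argmin_set f"
proof -
  have dec: "decseq (\<lambda>k. \<epsilon> (Suc k))" unfolding decseq_Suc_iff by (simp add: eps_Suc_le)
  note conv = tikhonov_minimizers_converge[OF f_convex f_continuous argmin_nonempty _ dec eps_Suc_tendsto, of "\<lambda>k. m (Suc k)"]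
  show "m \<longlonglongrightarrow> p" unfolding p_def by (rule LIMSEQ_imp_Suc, rule conv) (auto intro: eps_pos m_le)
  show "p \<in> argmin_set f" unfolding p_def by (rule conv) (auto intro: eps_pos m_le)
qed

lemma p_le: "f p \<le> f u"
  using p_argmin by (rule argmin_le)

lemma norm_m_le: "k \<ge> 1 \<Longrightarrow> norm (m k) \<le> norm p"
  using norm_tikhonov_minimizer_le[OF m_le p_le eps_pos] by blast

lemma gap_growth: "k \<ge> 1 \<Longrightarrow> \<epsilon> k / 2 * (norm (x k - m k))\<^sup>2 \<le> gap k"
  unfolding gap_def by (rule tikhonov_growth[OF f_convex m_le])

lemma gap_nonneg: "k \<ge> 1 \<Longrightarrow> 0 \<le> gap k"
  using m_le by (simp add: gap_def)

lemma energy_nonneg: "0 \<le> energy n"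
  using gap_nonneg s_pos by (simp add: energy_def)

lemma t_at_top: "filterlim t at_top sequentially"
proof -
  have "filterlim (\<lambda>n. 1 / (2 * s) * q n) at_top sequentially"
    by (rule filterlim_tendsto_pos_mult_at_top[OF tendsto_const _ q_at_top]) (use s_pos in simp)
  then show ?thesis by (simp add: t_def[abs_def])
qed

lemma t_ge: "\<forall>\<^sub>F n in sequentially. c \<le> t n"
  using t_at_top unfolding filterlim_at_top by blast

lemma t_step: "\<forall>\<^sub>F n in sequentially. t n \<le> t (Suc n) \<and> t (Suc n) \<le> t n + 3 / 8"
  using q_mono q_increment_le by eventually_elim (use s_pos in \<open>auto simp: t_def field_simps\<close>)

lemma scale_eq: "scale n = (q n)\<^sup>2 * \<epsilon> n / (2 * s)\<^sup>2"
  by (simp add: scale_def t_def power_divide)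

lemma scale_mono: "\<forall>\<^sub>F n in sequentially. scale n \<le> scale (Suc n)"
  using q2eps_mono by eventually_elim (simp add: scale_eq divide_right_mono)

lemma scale_at_top: "filterlim scale at_top sequentially"
proof -
  have "filterlim (\<lambda>n. 1 / (2 * s)\<^sup>2 * ((q n)\<^sup>2 * \<epsilon> n)) at_top sequentially"
    by (rule filterlim_tendsto_pos_mult_at_top[OF tendsto_const _ q2eps_lim]) (use s_pos in simp)
  then show ?thesis by (simp add: scale_eq[abs_def])
qed

lemma scale_Suc_ge: "\<forall>\<^sub>F n in sequentially. c \<le> scale (Suc n)"
  using scale_at_top unfolding filterlim_at_top by (subst eventually_sequentially_Suc) blast

section \<open>Perturbation terms and the recursion for the energy\<close>

definition drift where
  "drift n = t (Suc n) * (\<epsilon> (Suc n) - \<epsilon> (Suc (Suc n))) / \<epsilon> (Suc n)"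

lemma drift_tendsto: "drift \<longlonglongrightarrow> 0"
proof -
  have "(\<lambda>k. 1 / (2 * s) * (q k * (\<epsilon> k - \<epsilon> (k + 1)) / \<epsilon> k)) \<longlonglongrightarrow> 1 / (2 * s) * 0"
    by (intro tendsto_intros eps_diff_lim)
  from LIMSEQ_Suc[OF this] show ?thesis by (simp add: drift_def[abs_def] t_def)
qed

text \<open>The three errors of \<open>lyapunov_shift\<close>: the coefficient \<open>c\<close>
  (with \<open>C = 12\<close>), the decrease of \<epsilon>, and the displacement of the
  minimizer.\<close>

definition err where
  "err n = 2 * (17 * 12\<^sup>2 * (norm p)\<^sup>2 / (s * t n))
    + (t (Suc n))\<^sup>2 * ((\<epsilon> (Suc n) - \<epsilon> (Suc (Suc n))) / 2 * (norm p)\<^sup>2)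
    + 17 * t n * (norm (m (Suc (Suc n)) - m (Suc n)))\<^sup>2 / (2 * s)"

text \<open>Bridges an index mismatch: the energy is weighted with \<open>t n\<close>, the scale
  with \<open>t (Suc n)\<close>.\<close>

lemma scale_le_4: "\<forall>\<^sub>F n in sequentially. scale (Suc n) \<le> 4 * ((t n)\<^sup>2 * \<epsilon> (Suc n))"
  using t_step t_ge[of 1]
proof eventually_elim
  case (elim n)
  then have "(t (Suc n))\<^sup>2 \<le> (2 * t n)\<^sup>2" by (intro power_mono) auto
  then have "(t (Suc n))\<^sup>2 * \<epsilon> (Suc n) \<le> (2 * t n)\<^sup>2 * \<epsilon> (Suc n)"
    using eps_pos[of "Suc n"] by (intro mult_right_mono) auto
  then show ?case by (simp add: scale_def power_mult_distrib)
qed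

lemma energy_step:
  "\<forall>\<^sub>F n in sequentially. energy (Suc n) \<le> (1 - 1 / (8 * t n)) * energy n + err n"
proof -
  have lim: "(\<lambda>n. t (Suc n) * coeff_b s \<epsilon> q n - t n) \<longlonglongrightarrow> - 3 / 2"
    using coeff_b_asymptotics by (simp add: t_def)
  have b1: "\<forall>\<^sub>F n in sequentially. - 16 / 10 < t (Suc n) * coeff_b s \<epsilon> q n - t n"
    and b2: "\<forall>\<^sub>F n in sequentially. t (Suc n) * coeff_b s \<epsilon> q n - t n < - 14 / 10"
    using lim by (auto intro: order_tendstoD)
  have c: "\<forall>\<^sub>F n in sequentially. (t (Suc n))\<^sup>2 * \<bar>coeff_c s \<epsilon> q (Suc n)\<bar> \<le> 12"
    using coeff_c_bound by (simp add: t_def)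
  show ?thesis
    using b1 b2 c t_step t_ge[of 3] scale_le_4 scale_Suc_ge[of "4 * 32 * (1 + 17 * 12\<^sup>2) / s"]
      eventually_sequentially_Suc[THEN iffD2, OF step_size]
  proof eventually_elim
    case (elim n)
    define b c where "b = coeff_b s \<epsilon> q n" and "c = coeff_c s \<epsilon> q (Suc n)"
    define e where "e = \<epsilon> (Suc n)"
    \<comment> \<open>Solves the factorization required by \<open>lyapunov_step\<close>. The margins
      around \<open>- 3 / 2\<close> and \<open>3 \<le> t n\<close> put \<open>\<rho> * t n\<close>
      between \<open>4 / 10\<close> and \<open>9 / 10\<close>.\<close>
    define \<rho> where "\<rho> = 1 - t (Suc n) * b / (t n - 1)"
    define G where "G = g (y (Suc n)) + e *\<^sub>R y (Suc n)"
    let ?F = "tikhonov f e"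
    let ?F' = "tikhonov f (\<epsilon> (Suc (Suc n)))"
    have e: "e > 0" using eps_pos by (simp add: e_def)
    have descent: "?F (y (Suc n) - s *\<^sub>R G) \<le> ?F u + inner G (y (Suc n) - u) - s / 2 * (norm G)\<^sup>2" for u
      unfolding G_def
      by (rule tikhonov_gradient_step[OF f_convex f_gradient g_lipschitz]) (use e s_pos elim in \<open>auto simp: e_def\<close>)
    have rho: "t (Suc n) * b = (1 - \<rho>) * (t n - 1)" using elim by (simp add: \<rho>_def)
    have "\<rho> * t n = (t n - 1 - t (Suc n) * b) * (t n / (t n - 1))"
      using elim by (simp add: \<rho>_def field_simps)
    moreover have "4 / 10 * 1 \<le> (t n - 1 - t (Suc n) * b) * (t n / (t n - 1))"
      "(t n - 1 - t (Suc n) * b) * (t n / (t n - 1)) \<le> 6 / 10 * (3 / 2)"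
      using elim unfolding b_def[symmetric] by (intro mult_mono; simp add: field_simps)+
    ultimately have rho': "3 / 8 \<le> \<rho> * t n" "\<rho> * t n \<le> 1" by linarith+
    have big: "32 * (1 + 17 * 12\<^sup>2) \<le> s * (t n)\<^sup>2 * e"
    proof -
      have "4 * 32 * (1 + 17 * 12\<^sup>2) / s \<le> 4 * ((t n)\<^sup>2 * e)"
        using elim unfolding e_def by (blast intro: order_trans)
      then show ?thesis using s_pos by (simp add: field_simps)
    qed
    have x2: "x (Suc (Suc n)) = y (Suc n) - s *\<^sub>R G" by (simp add: x_step G_def e_def)
    have le: "?F' u \<le> ?F u" "?F u = ?F' u + (e - \<epsilon> (Suc (Suc n))) / 2 * (norm u)\<^sup>2" for u
    proof -
      show *: "?F u = ?F' u + (e - \<epsilon> (Suc (Suc n))) / 2 * (norm u)\<^sup>2" by (rule tikhonov_change)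
      show "?F' u \<le> ?F u" unfolding * using eps_Suc_le[of "Suc n"] by (simp add: e_def)
    qed
    have "(e - \<epsilon> (Suc (Suc n))) / 2 * (norm (m (Suc (Suc n))))\<^sup>2 \<le> (e - \<epsilon> (Suc (Suc n))) / 2 * (norm p)\<^sup>2"
      using eps_Suc_le[of "Suc n"] norm_m_le[of "Suc (Suc n)"]
      by (intro mult_left_mono power_mono) (auto simp: e_def)
    \<comment> \<open>Decreasing \<epsilon> lowers the value at the iterate; it lowers the minimum
      by at most the penalty difference at the new minimizer, whose norm is bounded by
      \<open>norm p\<close>.\<close>
    then have gap_shift: "gap (Suc (Suc n)) \<le> (?F (y (Suc n) - s *\<^sub>R G) - ?F (m (Suc n)))
        + (e - \<epsilon> (Suc (Suc n))) / 2 * (norm p)\<^sup>2"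
      using le(1)[of "x (Suc (Suc n))"] le(2)[of "m (Suc (Suc n))"] m_le[of "Suc n" "m (Suc (Suc n))"]
      unfolding gap_def x2[symmetric] e_def[symmetric] by simp
    have shift: "(t (Suc n))\<^sup>2 * gap (Suc (Suc n))
        + (norm (t (Suc n) *\<^sub>R (y (Suc n) - s *\<^sub>R G) - (t (Suc n) - 1) *\<^sub>R x (Suc n) - m (Suc (Suc n))))\<^sup>2 / (2 * s)
      \<le> (1 - 1 / (8 * t n)) * energy n + (2 * (17 * 12\<^sup>2 * (norm p)\<^sup>2 / (s * t n))
        + (t (Suc n))\<^sup>2 * ((e - \<epsilon> (Suc (Suc n))) / 2 * (norm p)\<^sup>2)
        + 17 * t n * (norm (m (Suc (Suc n)) - m (Suc n)))\<^sup>2 / (2 * s))"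
    proof (rule lyapunov_shift[OF s_pos _ _ gap_shift energy_nonneg])
      show "(t (Suc n))\<^sup>2 * (?F (y (Suc n) - s *\<^sub>R G) - ?F (m (Suc n)))
          + (norm (t (Suc n) *\<^sub>R (y (Suc n) - s *\<^sub>R G) - (t (Suc n) - 1) *\<^sub>R x (Suc n) - m (Suc n)))\<^sup>2 / (2 * s)
        \<le> (1 - 3 / (16 * t n)) * energy n + 17 * 12\<^sup>2 * (norm p)\<^sup>2 / (s * t n)"
        unfolding energy_def gap_def e_def[symmetric]
        by (rule lyapunov_step[where F = ?F and b = b and c = c,
            OF s_pos e _ _ _ descent descent _ _ _ rho rho' _ big])
          (use elim gap_growth[of "Suc n"] norm_m_le[of "Suc n"] y_step[of n]
            in \<open>auto simp: gap_def e_def b_def c_def\<close>)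
      show "0 \<le> ?F (y (Suc n) - s *\<^sub>R G) - ?F (m (Suc n))" using m_le[of "Suc n"] by (simp add: e_def)
    qed (use elim s_pos in auto)
    have "t (Suc n) *\<^sub>R (y (Suc n) - s *\<^sub>R G) - (t (Suc n) - 1) *\<^sub>R x (Suc n) - m (Suc (Suc n))
      = x (Suc (Suc n)) - m (Suc (Suc n)) + (t (Suc n) - 1) *\<^sub>R (x (Suc (Suc n)) - x (Suc n))"
      unfolding x2[symmetric] by (simp add: algebra_simps)
    with shift show ?case unfolding energy_def[of "Suc n"] err_def e_def by simp
  qed
qed

text \<open>The summands of \<open>err n\<close> multiplied by
  \<open>8 * t n / scale (Suc n)\<close>, the last two majorized through
  \<open>drift n\<close>.\<close>

definition \<delta> where
  "\<delta> n = (8 * 34 * 12\<^sup>2 * (norm p)\<^sup>2 / s) * inverse (scale (Suc n)) + 4 * (norm p)\<^sup>2 * drift n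
    + (272 * (norm p)\<^sup>2 / s) * (drift n)\<^sup>2 * inverse (scale (Suc n))"

lemma \<delta>_tendsto: "\<delta> \<longlonglongrightarrow> 0"
proof -
  have "(\<lambda>n. inverse (scale (Suc n))) \<longlonglongrightarrow> 0"
    by (intro LIMSEQ_Suc tendsto_inverse_0_at_top scale_at_top)
  then have "\<delta> \<longlonglongrightarrow> (8 * 34 * 12\<^sup>2 * (norm p)\<^sup>2 / s) * 0 + 4 * (norm p)\<^sup>2 * 0
    + (272 * (norm p)\<^sup>2 / s) * 0\<^sup>2 * 0"
    unfolding \<delta>_def[abs_def] by (intro tendsto_intros drift_tendsto)
  then show ?thesis by simp
qed

lemma err_le: "\<forall>\<^sub>F n in sequentially. err n \<le> scale (Suc n) * (1 / (8 * t n) * \<delta> n)"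
  using t_step t_ge[of 1] scale_Suc_ge[of 1]
proof eventually_elim
  case (elim n)
  define e D M R where "e = \<epsilon> (Suc n)" and "D = \<epsilon> (Suc n) - \<epsilon> (Suc (Suc n))"
    and "M = norm p" and "R = scale (Suc n)"
  have e: "e > 0" "D \<ge> 0" "M \<ge> 0" "R > 0"
    using eps_pos eps_Suc_le[of "Suc n"] elim by (auto simp: e_def D_def M_def R_def)
  have T: "1 \<le> t n" "t n \<le> t (Suc n)" using elim by auto
  have R: "R = (t (Suc n))\<^sup>2 * e" by (simp add: R_def scale_def e_def)
  have drift: "drift n = t (Suc n) * D / e" by (simp add: drift_def D_def e_def)
  have 2: "(t (Suc n))\<^sup>2 * (D / 2 * M\<^sup>2) \<le> R * (1 / (8 * t n) * (4 * M\<^sup>2 * drift n))"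
  proof -
    have "t n * ((t (Suc n))\<^sup>2 * (D / 2 * M\<^sup>2)) \<le> t (Suc n) * ((t (Suc n))\<^sup>2 * (D / 2 * M\<^sup>2))"
      using T e by (intro mult_right_mono) auto
    also have "\<dots> = t n * (R * (1 / (8 * t n) * (4 * M\<^sup>2 * drift n)))"
      unfolding R drift using T e by simp
    finally show ?thesis using T by (subst (asm) mult_le_cancel_left_pos) auto
  qed
  \<comment> \<open>The linear displacement bound makes \<open>t n\<close> times the displacement at
    most \<open>2 * M * drift n\<close>.\<close>
  have "norm (m (Suc (Suc n)) - m (Suc n)) \<le> 2 * M * (D / e)"
    unfolding e_def D_def M_def
    by (rule norm_minimizers_diff_le[OF f_convex])
      (auto intro: eps_pos eps_Suc_le m_le norm_m_le)
  then have "t n * norm (m (Suc (Suc n)) - m (Suc n)) \<le> t (Suc n) * (2 * M * (D / e))"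
    using T e by (intro mult_mono) auto
  then have "(t n * norm (m (Suc (Suc n)) - m (Suc n)))\<^sup>2 \<le> (2 * M * drift n)\<^sup>2"
    using T unfolding drift by (intro power_mono) (auto simp: mult_ac)
  then have "(t n)\<^sup>2 * (norm (m (Suc (Suc n)) - m (Suc n)))\<^sup>2 \<le> 4 * M\<^sup>2 * (drift n)\<^sup>2"
    by (simp add: power_mult_distrib)
  then have "(17 / (2 * s) / t n) * ((t n)\<^sup>2 * (norm (m (Suc (Suc n)) - m (Suc n)))\<^sup>2)
      \<le> (17 / (2 * s) / t n) * (4 * M\<^sup>2 * (drift n)\<^sup>2)"
    using s_pos T by (intro mult_left_mono) auto
  moreover have "(17 / (2 * s) / t n) * ((t n)\<^sup>2 * (norm (m (Suc (Suc n)) - m (Suc n)))\<^sup>2)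
      = 17 * t n * (norm (m (Suc (Suc n)) - m (Suc n)))\<^sup>2 / (2 * s)"
    using T by (simp add: power2_eq_square)
  moreover have "(17 / (2 * s) / t n) * (4 * M\<^sup>2 * (drift n)\<^sup>2)
      = R * (1 / (8 * t n) * ((272 * M\<^sup>2 / s) * (drift n)\<^sup>2 * inverse R))"
    using e T s_pos by (simp add: field_simps)
  moreover have "2 * (17 * 12\<^sup>2 * M\<^sup>2 / (s * t n)) = R * (1 / (8 * t n) * ((8 * 34 * 12\<^sup>2 * M\<^sup>2 / s) * inverse R))"
    using e T s_pos by (simp add: field_simps)
  moreover have "R * (1 / (8 * t n) * \<delta> n) = R * (1 / (8 * t n) * ((8 * 34 * 12\<^sup>2 * M\<^sup>2 / s) * inverse R))
      + R * (1 / (8 * t n) * (4 * M\<^sup>2 * drift n))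
      + R * (1 / (8 * t n) * ((272 * M\<^sup>2 / s) * (drift n)\<^sup>2 * inverse R))"
    unfolding \<delta>_def M_def[symmetric] R_def[symmetric] by (simp only: distrib_left)
  ultimately show ?case
    using 2 unfolding err_def M_def[symmetric] R_def[symmetric] D_def[symmetric] by linarith
qed

definition ratio where "ratio n = energy n / scale (Suc n)"

lemma ratio_tendsto: "ratio \<longlonglongrightarrow> 0"
proof (rule damped_recursion_tendsto_zero[where a = "\<lambda>n. 1 / (8 * t n)" and \<delta> = \<delta>])
  show "\<forall>\<^sub>F n in sequentially. 0 \<le> ratio n"
    using scale_Suc_ge[of 1] by eventually_elim (simp add: ratio_def energy_nonneg)
  show "\<forall>\<^sub>F n in sequentially. 0 \<le> 1 / (8 * t n) \<and> 1 / (8 * t n) \<le> 1"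
    using t_ge[of 1] by eventually_elim (auto simp: field_simps)
  show "\<not> summable (\<lambda>n. 1 / (8 * t n))"
    by (rule not_summable_inverse_linear_growth) (use t_step t_ge[of 1] in eventually_elim, auto)
  show "\<delta> \<longlonglongrightarrow> 0" by (rule \<delta>_tendsto)
  show "\<forall>\<^sub>F n in sequentially. ratio (Suc n) \<le> (1 - 1 / (8 * t n)) * ratio n + 1 / (8 * t n) * \<delta> n"
    using energy_step err_le scale_Suc_ge[of 1] scale_mono[THEN eventually_sequentially_Suc[THEN iffD2]]
  proof eventually_elim
    case (elim n)
    \<comment> \<open>Here the monotonicity of \<open>(q k)\<^sup>2 * \<epsilon> k\<close> enters:
      the later denominator may be replaced by the earlier one.\<close>
    have "ratio (Suc n) \<le> energy (Suc n) / scale (Suc n)"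
      unfolding ratio_def using elim energy_nonneg[of "Suc n"] by (intro divide_left_mono) auto
    also have "\<dots> \<le> ((1 - 1 / (8 * t n)) * energy n + scale (Suc n) * (1 / (8 * t n) * \<delta> n)) / scale (Suc n)"
      using elim by (intro divide_right_mono) auto
    also have "\<dots> = (1 - 1 / (8 * t n)) * ratio n + 1 / (8 * t n) * \<delta> n"
      using elim by (simp add: ratio_def add_divide_distrib)
    finally show ?case .
  qed
qed

text \<open>Each nonnegative summand of the energy is at most
  \<open>4 * ratio n * ((t n)\<^sup>2 * \<epsilon> (Suc n))\<close>. The gap bound follows on
  dividing by \<open>(t n)\<^sup>2\<close>, the distance bound by quadratic growth, and the velocity
  is the energy vector minus \<open>B\<close>, divided by \<open>t n - 1\<close>.\<close>

lemma estimates: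
  "\<forall>\<^sub>F n in sequentially. gap (Suc n) \<le> 4 * ratio n * \<epsilon> (Suc n)
    \<and> (norm (x (Suc n) - m (Suc n)))\<^sup>2 \<le> 8 * ratio n
    \<and> (norm (x (Suc n) - x n))\<^sup>2 \<le> (64 * s + 256) * ratio n * \<epsilon> (Suc n)"
  using scale_le_4 scale_Suc_ge[of 1] t_ge[of 2]
proof eventually_elim
  case (elim n)
  define e where "e = \<epsilon> (Suc n)"
  have e: "e > 0" using eps_pos by (simp add: e_def)
  have energy: "energy n \<le> 4 * ratio n * ((t n)\<^sup>2 * e)"
  proof -
    have "energy n = ratio n * scale (Suc n)" using elim by (simp add: ratio_def)
    also have "\<dots> \<le> ratio n * (4 * ((t n)\<^sup>2 * e))"
      using elim energy_nonneg[of n] by (intro mult_left_mono) (auto simp: ratio_def e_def)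
    finally show ?thesis by simp
  qed
  have "(t n)\<^sup>2 * gap (Suc n) \<le> energy n" using s_pos by (simp add: energy_def)
  then have "(t n)\<^sup>2 * gap (Suc n) \<le> (t n)\<^sup>2 * (4 * ratio n * e)" using energy by (simp add: mult_ac)
  then have gap: "gap (Suc n) \<le> 4 * ratio n * e"
    using elim by (subst (asm) mult_le_cancel_left_pos) auto
  define B where "B = x (Suc n) - m (Suc n)"
  have "e / 2 * (norm B)\<^sup>2 \<le> e / 2 * (8 * ratio n)"
    using order_trans[OF gap_growth[of "Suc n"] gap[unfolded e_def]] by (simp add: e_def B_def mult_ac)
  then have B: "(norm B)\<^sup>2 \<le> 8 * ratio n" using e by (subst (asm) mult_le_cancel_left_pos) auto
  define V where "V = x (Suc n) - x n"
  have "(norm (B + (t n - 1) *\<^sub>R V))\<^sup>2 / (2 * s) \<le> energy n"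
    unfolding energy_def B_def V_def using gap_nonneg[of "Suc n"] by simp
  then have Z: "(norm (B + (t n - 1) *\<^sub>R V))\<^sup>2 \<le> 2 * s * energy n"
    using s_pos by (simp add: field_simps)
  \<comment> \<open>The bound on \<open>B\<close> has no factor \<open>e\<close>; as the scale is at
    least 1, it can be inserted together with \<open>(t n)\<^sup>2\<close>.\<close>
  have "1 * (8 * ratio n) \<le> (4 * ((t n)\<^sup>2 * e)) * (8 * ratio n)"
    using elim energy_nonneg[of n] by (intro mult_right_mono) (auto simp: ratio_def e_def)
  then have one: "8 * ratio n \<le> 32 * ratio n * ((t n)\<^sup>2 * e)" by (simp add: mult_ac)
  have "(t n / 2)\<^sup>2 * (norm V)\<^sup>2 \<le> (t n - 1)\<^sup>2 * (norm V)\<^sup>2"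
    using elim by (intro mult_right_mono power_mono) auto
  also have "\<dots> = (norm ((B + (t n - 1) *\<^sub>R V) + (- B)))\<^sup>2" by (simp add: power_mult_distrib)
  also have "\<dots> \<le> 2 * (norm (B + (t n - 1) *\<^sub>R V))\<^sup>2 + 2 * (norm B)\<^sup>2"
    using norm_add_sq_le[of 1 "B + (t n - 1) *\<^sub>R V" "- B"] by simp
  also have "\<dots> \<le> 2 * (2 * s * (4 * ratio n * ((t n)\<^sup>2 * e))) + 2 * (32 * ratio n * ((t n)\<^sup>2 * e))"
  proof -
    have "2 * s * energy n \<le> 2 * s * (4 * ratio n * ((t n)\<^sup>2 * e))"
      using energy s_pos by (intro mult_left_mono) auto
    then show ?thesis using Z B one by linarith
  qed
  also have "\<dots> = (t n / 2)\<^sup>2 * ((64 * s + 256) * ratio n * e)"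
    by (simp add: power_divide algebra_simps)
  finally have "(norm V)\<^sup>2 \<le> (64 * s + 256) * ratio n * e"
    using elim by (subst (asm) mult_le_cancel_left_pos) auto
  then show ?case using gap B by (simp add: e_def B_def V_def)
qed

section \<open>Strong convergence and rates\<close>

lemma x_tendsto: "x \<longlonglongrightarrow> p"
proof -
  have "(\<lambda>n. sqrt (8 * ratio n)) \<longlonglongrightarrow> sqrt (8 * 0)" by (intro tendsto_intros ratio_tendsto)
  then have lim: "(\<lambda>n. sqrt (8 * ratio n)) \<longlonglongrightarrow> 0" by simp
  have "\<forall>\<^sub>F n in sequentially. norm (x (Suc n) - m (Suc n)) \<le> sqrt (8 * ratio n)"
    using estimates by eventually_elim (auto intro: real_le_rsqrt)
  then have "(\<lambda>n. x (Suc n) - m (Suc n)) \<longlonglongrightarrow> 0" by (rule Lim_null_comparison[OF _ lim])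
  from tendsto_add[OF this LIMSEQ_Suc[OF m_tendsto]] have "(\<lambda>n. x (Suc n)) \<longlonglongrightarrow> p" by simp
  then show ?thesis by (rule LIMSEQ_imp_Suc)
qed

lemma sqrt_eps_nonzero: "\<forall>\<^sub>F k in sequentially. sqrt (\<epsilon> k) \<noteq> 0"
  using eventually_ge_at_top[of 1] by eventually_elim (use eps_pos in force)

lemma gap_smallo: "gap \<in> o(\<epsilon>)"
proof (rule smalloI_tendsto)
  have "(\<lambda>n. 4 * ratio n) \<longlonglongrightarrow> 4 * 0" by (intro tendsto_intros ratio_tendsto)
  then have lim: "(\<lambda>n. 4 * ratio n) \<longlonglongrightarrow> 0" by simp
  have "(\<lambda>n. gap (Suc n) / \<epsilon> (Suc n)) \<longlonglongrightarrow> 0"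
  proof (rule Lim_null_comparison[OF _ lim])
    show "\<forall>\<^sub>F n in sequentially. norm (gap (Suc n) / \<epsilon> (Suc n)) \<le> 4 * ratio n"
      using estimates
    proof eventually_elim
      case (elim n)
      then show ?case using eps_pos[of "Suc n"] gap_nonneg[of "Suc n"] by (simp add: divide_le_eq)
    qed
  qed
  then show "(\<lambda>k. gap k / \<epsilon> k) \<longlonglongrightarrow> 0" by (rule LIMSEQ_imp_Suc)
  show "\<forall>\<^sub>F k in sequentially. \<epsilon> k \<noteq> 0"
    using eventually_ge_at_top[of 1] by eventually_elim (use eps_pos in force)
qed

lemma velocity_smallo: "(\<lambda>k. norm (x k - x (k - 1))) \<in> o(\<lambda>k. sqrt (\<epsilon> k))"
proof (rule smalloI_tendsto[OF _ sqrt_eps_nonzero])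
  have "(\<lambda>n. sqrt ((64 * s + 256) * ratio n)) \<longlonglongrightarrow> sqrt ((64 * s + 256) * 0)"
    by (intro tendsto_intros ratio_tendsto)
  then have lim: "(\<lambda>n. sqrt ((64 * s + 256) * ratio n)) \<longlonglongrightarrow> 0" by simp
  have "(\<lambda>n. norm (x (Suc n) - x n) / sqrt (\<epsilon> (Suc n))) \<longlonglongrightarrow> 0"
  proof (rule Lim_null_comparison[OF _ lim])
    show "\<forall>\<^sub>F n in sequentially. norm (norm (x (Suc n) - x n) / sqrt (\<epsilon> (Suc n)))
        \<le> sqrt ((64 * s + 256) * ratio n)"
      using estimates
    proof eventually_elim
      case (elim n)
      then have "norm (x (Suc n) - x n) \<le> sqrt ((64 * s + 256) * ratio n) * sqrt (\<epsilon> (Suc n))"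
        unfolding real_sqrt_mult[symmetric] by (intro real_le_rsqrt) auto
      then show ?case using eps_pos[of "Suc n"] by (simp add: divide_le_eq)
    qed
  qed
  then have "(\<lambda>n. norm (x (Suc n) - x (Suc n - 1)) / sqrt (\<epsilon> (Suc n))) \<longlonglongrightarrow> 0" by simp
  then show "(\<lambda>k. norm (x k - x (k - 1)) / sqrt (\<epsilon> k)) \<longlonglongrightarrow> 0" by (rule LIMSEQ_imp_Suc)
qed

lemma forward_velocity_smallo: "(\<lambda>k. norm (x (Suc k) - x k)) \<in> o(\<lambda>k. sqrt (\<epsilon> k))"
proof -
  have "(\<lambda>k. norm (x (Suc k) - x k)) \<in> o(\<lambda>k. sqrt (\<epsilon> (Suc k)))"
    using landau_o.small.compose[OF velocity_smallo filterlim_Suc] by simp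
  moreover have "(\<lambda>k. sqrt (\<epsilon> (Suc k))) \<in> O(\<lambda>k. sqrt (\<epsilon> k))"
    by (rule bigoI[where c = 1]) (use eventually_ge_at_top[of 1] in eventually_elim,
      use eps_pos eps_Suc_le in \<open>auto simp: abs_of_pos less_imp_le\<close>)
  ultimately show ?thesis by (rule landau_o.small_big_trans)
qed

lemma eps_smallo: "\<epsilon> \<in> o(\<lambda>k. sqrt (\<epsilon> k))"
proof (rule smalloI_tendsto[OF _ sqrt_eps_nonzero])
  have "(\<lambda>k. sqrt (\<epsilon> k)) \<longlonglongrightarrow> sqrt 0" by (intro tendsto_intros eps_lim)
  moreover have "\<forall>\<^sub>F k in sequentially. sqrt (\<epsilon> k) = \<epsilon> k / sqrt (\<epsilon> k)"
    using eventually_ge_at_top[of 1] by eventually_elim (use eps_pos in \<open>simp add: real_div_sqrt less_imp_le\<close>)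
  ultimately show "(\<lambda>k. \<epsilon> k / sqrt (\<epsilon> k)) \<longlonglongrightarrow> 0" by (simp add: Lim_transform_eventually)
qed

lemma norm_bounded: "\<forall>\<^sub>F k in sequentially. norm (u k) \<le> norm p + 1" if "u \<longlonglongrightarrow> p"
  using order_tendstoD(2)[OF tendsto_norm[OF that], of "norm p + 1"]
  by (simp add: eventually_mono less_imp_le)

text \<open>The difference consists of the velocity times the bounded coefficient \<open>b\<close>
  and of \<open>c\<close> times a bounded iterate, where \<open>c\<close> is of order
  \<epsilon>.\<close>

lemma x_y_smallo: "(\<lambda>k. norm (x k - y k)) \<in> o(\<lambda>k. sqrt (\<epsilon> k))"
proof (rule eventually_le_smallo)
  show "(\<lambda>k. 2 * norm (x k - x (k - 1)) + 12 * (norm p + 1) * \<epsilon> k) \<in> o(\<lambda>k. sqrt (\<epsilon> k))"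
    by (intro sum_in_smallo cmult_smallo velocity_smallo eps_smallo)
  have lim: "(\<lambda>n. t (Suc n) * coeff_b s \<epsilon> q n - t n) \<longlonglongrightarrow> - 3 / 2"
    using coeff_b_asymptotics by (simp add: t_def)
  have b1: "\<forall>\<^sub>F n in sequentially. - 2 < t (Suc n) * coeff_b s \<epsilon> q n - t n"
    and b2: "\<forall>\<^sub>F n in sequentially. t (Suc n) * coeff_b s \<epsilon> q n - t n < 0"
    by (rule order_tendstoD[OF lim], simp)+
  have c: "\<forall>\<^sub>F n in sequentially. (t (Suc n))\<^sup>2 * \<bar>coeff_c s \<epsilon> q (Suc n)\<bar> \<le> 12"
    using coeff_c_bound by (simp add: t_def)
  have "\<forall>\<^sub>F n in sequentially. \<bar>norm (x (Suc n) - y (Suc n))\<bar>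
      \<le> 2 * norm (x (Suc n) - x (Suc n - 1)) + 12 * (norm p + 1) * \<epsilon> (Suc n)"
    using b1 b2 c t_step t_ge[of 2] scale_Suc_ge[of 1]
      eventually_sequentially_Suc[THEN iffD2, OF norm_bounded[OF x_tendsto]]
  proof eventually_elim
    case (elim n)
    define b c where "b = coeff_b s \<epsilon> q n" and "c = coeff_c s \<epsilon> q (Suc n)"
    have T: "t (Suc n) > 0" using elim by simp
    have "t (Suc n) * b \<le> t (Suc n) * 2" "t (Suc n) * (- 2) \<le> t (Suc n) * b"
      using elim unfolding b_def[symmetric] by linarith+
    then have "b \<le> 2" "- 2 \<le> b" using T mult_le_cancel_left_pos by blast+
    then have "\<bar>b\<bar> \<le> 2" by simp
    moreover have "\<bar>c\<bar> \<le> 12 * \<epsilon> (Suc n)"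
    proof -
      \<comment> \<open>Since \<open>scale (Suc n) \<ge> 1\<close>, the order
        \<open>1 / (t (Suc n))\<^sup>2\<close> of \<open>c\<close> can be traded for
        \<open>\<epsilon> (Suc n)\<close>.\<close>
      have "\<bar>c\<bar> * 1 \<le> \<bar>c\<bar> * scale (Suc n)" using elim by (intro mult_left_mono) auto
      also have "\<dots> = ((t (Suc n))\<^sup>2 * \<bar>c\<bar>) * \<epsilon> (Suc n)" by (simp add: scale_def)
      also have "\<dots> \<le> 12 * \<epsilon> (Suc n)"
        using elim eps_pos[of "Suc n"] unfolding c_def by (intro mult_right_mono) auto
      finally show ?thesis by simp
    qed
    moreover have "x (Suc n) - y (Suc n) = c *\<^sub>R x (Suc n) - b *\<^sub>R (x (Suc n) - x n)"
      by (simp add: y_step b_def c_def)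
    then have "norm (x (Suc n) - y (Suc n)) \<le> \<bar>c\<bar> * norm (x (Suc n)) + \<bar>b\<bar> * norm (x (Suc n) - x n)"
      using norm_triangle_ineq4[of "c *\<^sub>R x (Suc n)" "b *\<^sub>R (x (Suc n) - x n)"] by simp
    moreover have "\<bar>c\<bar> * norm (x (Suc n)) \<le> (12 * \<epsilon> (Suc n)) * (norm p + 1)"
      using elim calculation(2) eps_pos[of "Suc n"] by (intro mult_mono) auto
    moreover have "\<bar>b\<bar> * norm (x (Suc n) - x n) \<le> 2 * norm (x (Suc n) - x n)"
      using calculation(1) by (intro mult_right_mono) auto
    ultimately show ?case by (simp add: mult_ac)
  qed
  then show "\<forall>\<^sub>F k in sequentially. \<bar>norm (x k - y k)\<bar>
      \<le> 2 * norm (x k - x (k - 1)) + 12 * (norm p + 1) * \<epsilon> k"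
    by (subst (asm) eventually_sequentially_Suc)
qed

lemma y_tendsto: "y \<longlonglongrightarrow> p"
proof -
  have "(\<lambda>k. sqrt (\<epsilon> k)) \<longlonglongrightarrow> sqrt 0" by (intro tendsto_intros eps_lim)
  moreover have "(\<lambda>k. norm (x k - y k) / sqrt (\<epsilon> k)) \<longlonglongrightarrow> 0"
    by (rule smalloD_tendsto[OF x_y_smallo])
  ultimately have "(\<lambda>k. norm (x k - y k) / sqrt (\<epsilon> k) * sqrt (\<epsilon> k)) \<longlonglongrightarrow> 0 * sqrt 0"
    by (intro tendsto_mult)
  moreover have "\<forall>\<^sub>F k in sequentially. norm (x k - y k) / sqrt (\<epsilon> k) * sqrt (\<epsilon> k) = norm (x k - y k)"
    using sqrt_eps_nonzero by eventually_elim simp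
  ultimately have "(\<lambda>k. norm (x k - y k)) \<longlonglongrightarrow> 0" by (simp add: Lim_transform_eventually)
  then have "(\<lambda>k. x k - (x k - y k)) \<longlonglongrightarrow> p - 0"
    by (intro tendsto_diff x_tendsto) (simp add: tendsto_norm_zero_iff)
  then show ?thesis by simp
qed

text \<open>The update rule is solved for the gradient, which becomes a sum of displacements and of
  a term of order \<epsilon>.\<close>

lemma gradient_y_smallo: "(\<lambda>k. norm (g (y k))) \<in> o(\<lambda>k. sqrt (\<epsilon> k))"
proof (rule eventually_le_smallo)
  show "(\<lambda>k. 1 / s * (norm (x k - y k) + norm (x (Suc k) - x k) + s * (norm p + 1) * \<epsilon> k))
      \<in> o(\<lambda>k. sqrt (\<epsilon> k))"
    by (intro sum_in_smallo cmult_smallo forward_velocity_smallo x_y_smallo eps_smallo)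
  show "\<forall>\<^sub>F k in sequentially. \<bar>norm (g (y k))\<bar>
      \<le> 1 / s * (norm (x k - y k) + norm (x (Suc k) - x k) + s * (norm p + 1) * \<epsilon> k)"
    using norm_bounded[OF y_tendsto] eventually_ge_at_top[of 1]
  proof eventually_elim
    case (elim k)
    then obtain n where k: "k = Suc n" by (cases k) auto
    have "s *\<^sub>R g (y k) = - (x k - y k) - (x (Suc k) - x k) - (s * \<epsilon> k) *\<^sub>R y k"
      using x_step[of n] unfolding k by (simp add: algebra_simps)
    then have "norm (s *\<^sub>R g (y k)) \<le> norm (x k - y k) + norm (x (Suc k) - x k) + norm ((s * \<epsilon> k) *\<^sub>R y k)"
      using norm_triangle_ineq4[of "- (x k - y k) - (x (Suc k) - x k)" "(s * \<epsilon> k) *\<^sub>R y k"]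
        norm_triangle_ineq4[of "- (x k - y k)" "x (Suc k) - x k"]
      by (smt (verit) norm_minus_cancel)
    moreover have "norm ((s * \<epsilon> k) *\<^sub>R y k) \<le> s * \<epsilon> k * (norm p + 1)"
      using elim s_pos eps_pos[of k] by (simp add: mult_left_mono)
    ultimately show ?case using s_pos by (simp add: field_simps)
  qed
qed

lemma gradient_x_smallo: "(\<lambda>k. norm (g (x k))) \<in> o(\<lambda>k. sqrt (\<epsilon> k))"
proof (rule eventually_le_smallo)
  show "(\<lambda>k. norm (g (y k)) + L * norm (x k - y k)) \<in> o(\<lambda>k. sqrt (\<epsilon> k))"
    by (intro sum_in_smallo cmult_smallo gradient_y_smallo x_y_smallo)
  have "norm (g (x k)) \<le> norm (g (y k)) + L * norm (x k - y k)" for k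
    using lipschitz_onD[OF g_lipschitz, of "x k" "y k"] norm_triangle_sub[of "g (x k)" "g (y k)"]
    by (simp add: dist_norm)
  then show "\<forall>\<^sub>F k in sequentially. \<bar>norm (g (x k))\<bar> \<le> norm (g (y k)) + L * norm (x k - y k)"
    by simp
qed

lemma Inf_eq: "(INF z. f z) = f p"
  using p_le by (intro cInf_eq_minimum) auto

text \<open>Testing the minimality of \<open>m k\<close> with \<open>p\<close> bounds the residual
  by the gap plus the penalty of \<open>p\<close>; the penalty is of exact order \<epsilon> when
  \<open>p\<close> is nonzero, hence the big O.\<close>

lemma x_value_bigo: "(\<lambda>k. f (x k) - (INF z. f z)) \<in> O(\<epsilon>)"
proof -
  have "(\<lambda>k. gap k + (norm p)\<^sup>2 / 2 * \<epsilon> k) \<in> O(\<epsilon>)"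
    by (intro sum_in_bigo landau_o.small_imp_big[OF gap_smallo]) simp
  moreover have "(\<lambda>k. f (x k) - (INF z. f z)) \<in> O(\<lambda>k. gap k + (norm p)\<^sup>2 / 2 * \<epsilon> k)"
  proof (rule bigoI[where c = 1])
    show "\<forall>\<^sub>F k in sequentially. norm (f (x k) - (INF z. f z)) \<le> 1 * norm (gap k + (norm p)\<^sup>2 / 2 * \<epsilon> k)"
      using eventually_ge_at_top[of 1]
    proof eventually_elim
      case (elim k)
      have "tikhonov f (\<epsilon> k) (m k) \<le> tikhonov f (\<epsilon> k) p" using m_le elim by simp
      moreover have "0 \<le> \<epsilon> k / 2 * (norm (x k))\<^sup>2" using eps_pos[OF elim] by simp
      ultimately show ?case
        using p_le[of "x k"] unfolding Inf_eq gap_def tikhonov_def by (simp add: mult.commute)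
    qed
  qed
  ultimately show ?thesis using landau_o.big_trans by blast
qed

text \<open>The tangent inequality at \<open>y k\<close>, evaluated at \<open>x k\<close>, leaves a
  product of two quantities that are each small against \<open>sqrt (\<epsilon> k)\<close>.\<close>

lemma y_value_bigo: "(\<lambda>k. f (y k) - (INF z. f z)) \<in> O(\<epsilon>)"
proof -
  have "(\<lambda>k. norm (g (y k)) * norm (x k - y k)) \<in> o(\<lambda>k. sqrt (\<epsilon> k) * sqrt (\<epsilon> k))"
    by (intro landau_o.small_mult gradient_y_smallo x_y_smallo)
  moreover have "(\<lambda>k. sqrt (\<epsilon> k) * sqrt (\<epsilon> k)) \<in> O(\<epsilon>)"
    by (rule bigoI[where c = 1]) (simp add: abs_mult)
  ultimately have "(\<lambda>k. norm (g (y k)) * norm (x k - y k)) \<in> O(\<epsilon>)"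
    by (meson landau_o.small_big_trans landau_o.small_imp_big)
  then have "(\<lambda>k. (f (x k) - (INF z. f z)) + norm (g (y k)) * norm (x k - y k)) \<in> O(\<epsilon>)"
    by (intro sum_in_bigo x_value_bigo)
  moreover have "(\<lambda>k. f (y k) - (INF z. f z))
      \<in> O(\<lambda>k. (f (x k) - (INF z. f z)) + norm (g (y k)) * norm (x k - y k))"
  proof (rule bigoI[where c = 1], rule always_eventually, rule allI)
    fix k
    have "f (y k) + inner (g (y k)) (x k - y k) \<le> f (x k)"
      by (rule convex_above_tangent[OF f_convex f_gradient])
    moreover have "- (norm (g (y k)) * norm (x k - y k)) \<le> inner (g (y k)) (x k - y k)"
      using Cauchy_Schwarz_ineq2[of "g (y k)" "x k - y k"] by linarith
    ultimately show "norm (f (y k) - (INF z. f z))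
        \<le> 1 * norm ((f (x k) - (INF z. f z)) + norm (g (y k)) * norm (x k - y k))"
      using p_le[of "y k"] unfolding Inf_eq by simp
  qed
  ultimately show ?thesis using landau_o.big_trans by blast
qed

end

theorem theorem5:
  fixes f :: "'a::{real_inner, complete_space} \<Rightarrow> real"
    and grad_f :: "'a \<Rightarrow> 'a"
    and \<epsilon> q :: "nat \<Rightarrow> real"
    and L s :: real
    and k0 k1 k2 kbar :: nat
    and x y :: "nat \<Rightarrow> 'a"
  assumes f_convex: "convex_on UNIV f"
    and f_gradient: "\<And>z. GDERIV f z :> grad_f z"
    and grad_continuous: "continuous_on UNIV grad_f"
    and L_pos: "L > 0"
    and grad_lipschitz: "L-lipschitz_on UNIV grad_f"
    and argmin_nonempty: "argmin_set f \<noteq> {}"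
    and eps_antimono: "antimono_on {1..} \<epsilon>"
    and eps_pos: "\<And>k. k \<ge> 1 \<Longrightarrow> \<epsilon> k > 0"
    and eps_lim: "\<epsilon> \<longlonglongrightarrow> 0"
    and s_bounds: "0 < s" "s < 1 / L"
    and k0: "k0 \<ge> 1" "s \<in> {0<..1 / (L + \<epsilon> k0)}"
    and k1: "k1 \<ge> k0" "\<And>k. k \<ge> k1 \<Longrightarrow> 1 - s * \<epsilon> k > 0"
    and k2: "k2 \<ge> k1"
      "\<And>k. k \<ge> k2 \<Longrightarrow>
        (1 - s * \<epsilon> (k + 1))\<^sup>2 * (q (k + 1))\<^sup>2 - (1 - s * \<epsilon> k)\<^sup>2 * (q k)\<^sup>2
          - 2 * s * q (k + 1) + s * (1 - s * \<epsilon> k)\<^sup>2 * q k \<le> 0"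
      "\<And>k. k \<ge> k2 \<Longrightarrow> q k \<ge> 2 * s / (1 - s * \<epsilon> k)\<^sup>2"
    and kbar: "kbar = k2 + 1"
    and y_step: "\<And>k. k \<ge> 1 \<Longrightarrow>
        y k = x k + coeff_b s \<epsilon> q (k - 1) *\<^sub>R (x k - x (k - 1)) - coeff_c s \<epsilon> q k *\<^sub>R x k"
    and x_step: "\<And>k. k \<ge> 1 \<Longrightarrow>
        x (k + 1) = y k - s *\<^sub>R grad_f (y k) - (s * \<epsilon> k) *\<^sub>R y k"
    and c_nonneg: "\<forall>\<^sub>F k in sequentially. coeff_c s \<epsilon> q k \<ge> 0"
    and c_lim: "coeff_c s \<epsilon> q \<longlonglongrightarrow> 0"
    and ratio_bounded: "bounded ((\<lambda>k. q k * \<epsilon> k / (q (k - 1) * \<epsilon> (k - 1))) ` {kbar..})"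
    and q2eps_mono: "mono_on {kbar - 1..} (\<lambda>k. (q k)\<^sup>2 * \<epsilon> k)"
    and q2eps_lim: "filterlim (\<lambda>k. (q k)\<^sup>2 * \<epsilon> k) at_top sequentially"
    and eps_diff_lim: "(\<lambda>k. q k * (\<epsilon> k - \<epsilon> (k + 1)) / \<epsilon> k) \<longlonglongrightarrow> 0"
  shows "x \<longlonglongrightarrow> min_norm_element (argmin_set f)
    \<and> (\<lambda>k. norm (x k - y k)) \<in> o(\<lambda>k. sqrt (\<epsilon> k))
    \<and> y \<longlonglongrightarrow> min_norm_element (argmin_set f)
    \<and> (\<lambda>k. tikhonov f (\<epsilon> k) (x k) - tikhonov f (\<epsilon> k) (tikhonov_minimizer f (\<epsilon> k))) \<in> o(\<epsilon>)
    \<and> (\<lambda>k. f (x k) - (INF z. f z)) \<in> O(\<epsilon>)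
    \<and> (\<lambda>k. f (y k) - (INF z. f z)) \<in> O(\<epsilon>)
    \<and> (\<lambda>k. norm (x k - x (k - 1))) \<in> o(\<lambda>k. sqrt (\<epsilon> k))
    \<and> (\<lambda>k. norm (grad_f (x k))) \<in> o(\<lambda>k. sqrt (\<epsilon> k))
    \<and> (\<lambda>k. norm (grad_f (y k))) \<in> o(\<lambda>k. sqrt (\<epsilon> k))"
proof -
  have eps_le: "\<epsilon> j \<le> \<epsilon> i" if "1 \<le> i" "i \<le> j" for i j
    using monotone_onD[OF eps_antimono, of i j] that by simp
  interpret tikhonov_inertial \<epsilon> q s f grad_f L x y
  proof (unfold_locales, goal_cases)
    case 5
    then show ?case using eventually_ge_at_top[of k2] by eventually_elim (use k2 in blast)
  next
    case 6
    show ?case using eventually_ge_at_top[of k2]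
    proof eventually_elim
      case (elim k)
      then have "0 < 2 * s / (1 - s * \<epsilon> k)\<^sup>2" using s_bounds(1) k1(2)[of k] k2(1) by simp
      then show ?case using k2(3)[OF elim] by linarith
    qed
  next
    case 7
    \<comment> \<open>The monotonicity hypothesis starts at \<open>kbar - 1\<close>, which is
      \<open>k2\<close>.\<close>
    show ?case using eventually_ge_at_top[of k2]
      by eventually_elim (use monotone_onD[OF q2eps_mono] kbar in auto)
  next
    case 14
    show ?case using eventually_ge_at_top[of k0]
    proof eventually_elim
      case (elim k)
      \<comment> \<open>The step size bound is given at \<open>k0\<close> only and passes to later
        indices because \<epsilon> does not increase.\<close>
      have "s * (L + \<epsilon> k) \<le> s * (L + \<epsilon> k0)"
        using s_bounds(1) eps_le[OF k0(1) elim] by (intro mult_left_mono) auto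
      also have "\<dots> \<le> 1"
        using k0(2) L_pos eps_pos[OF k0(1)] by (simp add: pos_le_divide_eq)
      finally show ?case .
    qed
  next
    case (15 n)
    show ?case using y_step[of "Suc n"] by simp
  next
    case (16 n)
    show ?case using x_step[of "Suc n"] by (simp add: algebra_simps)
  qed (use assms in \<open>auto intro: eps_pos\<close>)
  show ?thesis
    using x_tendsto x_y_smallo y_tendsto gap_smallo x_value_bigo y_value_bigo velocity_smallo
      gradient_x_smallo gradient_y_smallo
    unfolding p_def gap_def[abs_def] m_def by blast
qed

end
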